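(* Let $F=f+r$ on $\mathbb{E}=\mathbb{E}_1\times\cdots\times\mathbb{E}_s$, let $\{\tilde x^{(k)}\}$ be generated by the inertial block proximal method (IBP) or the inertial block proximal gradient method (IBPG) with Bregman divergences $D_i$, as described in the context, and suppose Assumptions 1, 2 and 3 of the context hold. (i) For IBP: if $F$ is regular (at every point of its domain), then every limit point of the sequence $\{\tilde x^{(k)}\}$ is a critical point type I of $F$. If $f$ is continuously differentiable, then every limit point of $\{\tilde x^{(k)}\}$ is a critical point type II of $F$. (ii) For IBPG, with $f$ continuously differentiable: every limit point of the sequence $\{\tilde x^{(k)}\}$ is a critical point type II of $F$.
   Context: **Problem.** $\mathbb{E}=\mathbb{E}_1\times\cdots\times\mathbb{E}_s$, each $\mathbb{E}_i$ a finite-dimensional real space with inner product $\langle\cdot,\cdot\rangle$ and its associated norm $\|\cdot\|$; $\|x\|^2=\sum_i\|x_i\|^2$ on $\mathbb{E}$. $F(x)=f(x)+r(x)$, where $f:\mathbb{E}\to\mathbb{R}$ is continuous (possibly non-smooth, non-convex) and $r(x)=\sum_{i=1}^s r_i(x_i)$ with $r_i:\mathbb{E}_i\to\mathbb{R}\cup\{+\infty\}$ proper and lower semicontinuous. **Bregman distance.** $H_i:\mathbb{E}_i\to\mathbb{R}$ is strictly convex and continuously differentiable, $D_i(u,v)=H_i(u)-H_i(v)-\langle\nabla H_i(v),u-v\rangle$. **Algorithm.** Choose $\tilde x^{(0)}=\tilde x^{(-1)}\in\mathbb{E}$ and choose a method, IBP or IBPG. For $k=1,2,\dots$: set $x^{(k,0)}=\tilde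 x^{(k-1)}$; for $j=1,\dots,T_k$, choose a block $i\in\{1,\dots,s\}$ (deterministically or randomly), let $y_i$ be the value of the $i$th block before it was updated to $x_i^{(k,j-1)}$ (initially $y_i=\tilde x_i^{(-1)}$), let $f_i^{(k,j)}(x_i)=f(x_1^{(k,j-1)},\dots,x_{i-1}^{(k,j-1)},x_i,x_{i+1}^{(k,j-1)},\dots,x_s^{(k,j-1)})$ and $F_i^{(k,j)}=f_i^{(k,j)}+r_i$, and set $\hat x_i=x_i^{(k,j-1)}+\alpha_i^{(k,j)}(x_i^{(k,j-1)}-y_i)$. - IBP: $x_i^{(k,j)}\in\operatorname{argmin}_{u\in\mathbb{E}_i}\{F_i^{(k,j)}(u)+\frac{1}{\beta_i^{(k,j)}}D_i(u,\hat x_i)\}$. - IBPG: set $\grave x_i=x_i^{(k,j-1)}+\gamma_i^{(k,j)}(x_i^{(k,j-1)}-y_i)$ and $x_i^{(k,j)}\in\operatorname{argmin}_{u\in\mathbb{E}_i}\{r_i(u)+\langle\nabla f_i^{(k,j)}(\grave x_i),u\rangle+\frac{1}{\beta_i^{(k,j)}}D_i(u,\hat x_i)\}$. The other blocks are unchanged: $x_{i'}^{(k,j)}=x_{i'}^{(k,j-1)}$ for $i'\neq i$. After the inner loop, $\tilde x^{(k)}=x^{(k,T_k)}$. **Notation.** $d_i^k$ is the number of times block $i$ is updated during the $k$th outer loop. $\bar x_i^{(k,m)}$, $m=1,\dots,d_i^k$, is the value of block $i$ after its $m$th update in the $k$th outer loop; $\bar x_i^{(k,0)}=\tilde x_i^{(k-1)}$,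 $\bar x_i^{(k,d_i^k)}=\tilde x_i^{(k)}$, and $\bar x_i^{(k,-1)}=\bar x_i^{(k-1,d_i^{k-1}-1)}$ (with $\bar x_i^{(1,-1)}=\tilde x_i^{(-1)}$). $\bar\alpha_i^{(k,m)},\bar\beta_i^{(k,m)},\bar\gamma_i^{(k,m)}$ (and $\bar L_i^{(k,m)}$ below) are the values of $\alpha_i^{(k,j)},\beta_i^{(k,j)},\gamma_i^{(k,j)}$ (and $L_i^{(k,j)}$) used when updating $\bar x_i^{(k,m-1)}$ to $\bar x_i^{(k,m)}$. The $\alpha$'s and $\gamma$'s are nonnegative, the $\beta$'s positive. **Assumption 1.** For every $k$, all blocks are updated within the $T_k$ iterations of the $k$th outer loop, and $s\le T_k\le\bar T$ for a constant $\bar T$. **Assumption 2.** (A1) $H_i$ is $\sigma_i$-strongly convex ($\sigma_i>0$) and continuously differentiable, and $\nabla H_i$ is $L_{H_i}$-Lipschitz continuous, $i=1,\dots,s$. (A2) The proximal maps (argmin sets) used in the updates are well-defined (nonempty). **Choice of parameters.** Fix $0<\nu<1$ and $\delta>1$. - IBP: with $\theta_i^{(k,m)}=\frac{(L_{H_i}\bar\alpha_i^{(k,m)})^2}{2\nu\sigma_i\bar\beta_i^{(k,m)}}$ for $1\le m\le d_i^k$ and $\theta_i^{(k,d_i^k+1)}=\theta_i^{(k+1,1)}$, the parameters satisfy $\frac{(1-\nu)\sigma_i}{2\bar\beta_i^{(k,m)}}\ge\delta\,\theta_i^{(k,m+1)}$ for $m=1,\dots,d_i^k$ and all $i,k$.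 - IBPG: $\nabla f_i^{(k,j)}$ is $L_i^{(k,j)}$-Lipschitz continuous, $L_i^{(k,j)}>0$; for a fixed $\kappa>1$, $\bar\beta_i^{(k,m)}=\frac{\sigma_i}{\kappa\bar L_i^{(k,m)}}$; with $\lambda_i^{(k,m)}=\frac12\Big(\bar\gamma_i^{(k,m)}+\frac{\kappa L_{H_i}\bar\alpha_i^{(k,m)}}{\sigma_i}\Big)^2\frac{\bar L_i^{(k,m)}}{\nu(\kappa-1)}$ for $1\le m\le d_i^k$ and $\lambda_i^{(k,d_i^k+1)}=\lambda_i^{(k+1,1)}$, the parameters satisfy $\frac{(1-\nu)(\kappa-1)\bar L_i^{(k,m)}}{2}\ge\delta\,\lambda_i^{(k,m+1)}$ for $m=1,\dots,d_i^k$ and all $i,k$. **Assumption 3.** For IBP there are positive numbers $W_1,\overline\alpha,\underline\beta$ with $\theta_i^{(k,m)}\ge W_1$, $\bar\alpha_i^{(k,m)}\le\overline\alpha$, $\underline\beta\le\bar\beta_i^{(k,m)}$ for all $k$, $m=1,\dots,d_i^k$, $i=1,\dots,s$. For IBPG there are positive numbers $W_1,\overline L,\overline\alpha,\overline\gamma$ with $\lambda_i^{(k,m)}\ge W_1$, $\bar L_i^{(k,m)}\le\overline L$, $\bar\alpha_i^{(k,m)}\le\overline\alpha$, $\bar\gamma_i^{(k,m)}\le\overline\gamma$ for all such $k,m,i$. **Critical points.** For $g:\mathbb{E}\to\mathbb{R}\cup\{+\infty\}$ proper lower semicontinuous and $x\in\operatorname{dom}g$: $g'(x;d)=\liminf_{\tau\downarrow0}\frac{g(x+\tau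 d)-g(x)}{\tau}$; the Fréchet subdifferential $\hat\partial g(x)$ is the set of $v$ with $\liminf_{y\ne x,y\to x}\frac{g(y)-g(x)-\langle v,y-x\rangle}{\|y-x\|}\ge0$; the limiting subdifferential $\partial g(x)$ is the set of $v$ for which there exist $x^{(k)}\to x$, $g(x^{(k)})\to g(x)$, $v^{(k)}\in\hat\partial g(x^{(k)})$, $v^{(k)}\to v$. A point $x^*\in\operatorname{dom}F$ is a critical point type I of $F$ if $F'(x^*;d)\ge0$ for all $d$; it is a critical point type II of $F$ if $0\in\partial F(x^* )$. $F$ is regular at $x\in\operatorname{dom}F$ if for all $d=(d_1,\dots,d_s)$ with $F'(x;(0,\dots,d_i,\dots,0))\ge0$ for $i=1,\dots,s$, one has $F'(x;d)\ge0$. *)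

theory Defs
  imports "HOL-Analysis.Analysis"
begin

section \<open>Analysis on a finite-dimensional inner product space\<close>

text \<open>
  The blocks of a product may have different dimensions. Every finite family of
  finite-dimensional real inner product spaces embeds isometrically into one Euclidean space,
  so each space is a linear subspace \<open>S\<close> of a Euclidean type, and
  all notions below are relative to \<open>S\<close>: points, directions and subgradients range over \<open>S\<close>, and
  limits are taken within \<open>S\<close>. The values of functions outside \<open>S\<close> are irrelevant.
\<close>

definition gradient_on :: "'b::euclidean_space set \<Rightarrow> ('b \<Rightarrow> real) \<Rightarrow> 'b \<Rightarrow> 'b" where
  "gradient_on S h x = (THE g. g \<in> S \<and> (h has_derivative (\<lambda>v. g \<bullet> v)) (at x within S))"

definition C1_on :: "'b::euclidean_space set \<Rightarrow> ('b \<Rightarrow> real) \<Rightarrow> bool" where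
  "C1_on S h \<longleftrightarrow> h differentiable_on S \<and> continuous_on S (gradient_on S h)"

definition strongly_convex_on :: "'b::euclidean_space set \<Rightarrow> real \<Rightarrow> ('b \<Rightarrow> real) \<Rightarrow> bool" where
  "strongly_convex_on S \<sigma> h \<longleftrightarrow>
     (\<forall>u\<in>S. \<forall>v\<in>S. \<forall>t\<in>{0..1}.
        h (t *\<^sub>R u + (1 - t) *\<^sub>R v)
          \<le> t * h u + (1 - t) * h v - \<sigma> / 2 * t * (1 - t) * (norm (u - v))\<^sup>2)"

definition proper_on :: "'b set \<Rightarrow> ('b \<Rightarrow> ereal) \<Rightarrow> bool" where
  "proper_on S g \<longleftrightarrow> (\<forall>u\<in>S. g u \<noteq> -\<infinity>) \<and> (\<exists>u\<in>S. g u \<noteq> \<infinity>)"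

definition lsc_on :: "'b::euclidean_space set \<Rightarrow> ('b \<Rightarrow> ereal) \<Rightarrow> bool" where
  "lsc_on S g \<longleftrightarrow> (\<forall>u\<in>S. g u \<le> Liminf (at u within S) g)"

definition edom :: "'b set \<Rightarrow> ('b \<Rightarrow> ereal) \<Rightarrow> 'b set" where
  "edom S g = {u \<in> S. g u < \<infinity>}"

definition dir_deriv :: "('b::euclidean_space \<Rightarrow> ereal) \<Rightarrow> 'b \<Rightarrow> 'b \<Rightarrow> ereal" where
  "dir_deriv g x d = Liminf (at_right 0) (\<lambda>\<tau>::real. (g (x + \<tau> *\<^sub>R d) - g x) / ereal \<tau>)"

definition frechet_subdiff :: "'b::euclidean_space set \<Rightarrow> ('b \<Rightarrow> ereal) \<Rightarrow> 'b \<Rightarrow> 'b set" where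
  "frechet_subdiff S g x =
     {v \<in> S. x \<in> edom S g \<and>
        0 \<le> Liminf (at x within S) (\<lambda>y. (g y - g x - ereal (v \<bullet> (y - x))) / ereal (norm (y - x)))}"

definition limiting_subdiff :: "'b::euclidean_space set \<Rightarrow> ('b \<Rightarrow> ereal) \<Rightarrow> 'b \<Rightarrow> 'b set" where
  "limiting_subdiff S g x =
     {v \<in> S. x \<in> edom S g \<and>
        (\<exists>X V. X \<longlonglongrightarrow> x \<and> (\<lambda>n. g (X n)) \<longlonglongrightarrow> g x \<and>
               (\<forall>n. V n \<in> frechet_subdiff S g (X n)) \<and> V \<longlonglongrightarrow> v)}"

definition critical_type_I :: "'b::euclidean_space set \<Rightarrow> ('b \<Rightarrow> ereal) \<Rightarrow> 'b \<Rightarrow> bool" where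
  "critical_type_I S g x \<longleftrightarrow> x \<in> edom S g \<and> (\<forall>d\<in>S. 0 \<le> dir_deriv g x d)"

definition critical_type_II :: "'b::euclidean_space set \<Rightarrow> ('b \<Rightarrow> ereal) \<Rightarrow> 'b \<Rightarrow> bool" where
  "critical_type_II S g x \<longleftrightarrow> x \<in> edom S g \<and> 0 \<in> limiting_subdiff S g x"

definition seq_limit_point :: "(nat \<Rightarrow> 'b::topological_space) \<Rightarrow> 'b \<Rightarrow> bool" where
  "seq_limit_point X x \<longleftrightarrow> (\<exists>\<rho>. strict_mono \<rho> \<and> (X \<circ> \<rho>) \<longlonglongrightarrow> x)"


section \<open>The block-structured problem\<close>

text \<open>The inner product and norm of type \<^typ>\<open>'a^'s\<close> are those of the product.\<close>

definition block_space :: "('s::finite \<Rightarrow> 'a::euclidean_space set) \<Rightarrow> ('a^'s) set" where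
  "block_space E = {x. \<forall>i. x $ i \<in> E i}"

definition block_upd :: "'a^'s \<Rightarrow> 's::finite \<Rightarrow> 'a \<Rightarrow> 'a^'s" where
  "block_upd x i u = (\<chi> l. if l = i then u else x $ l)"

definition objective ::
  "('a^'s \<Rightarrow> real) \<Rightarrow> ('s::finite \<Rightarrow> 'a::euclidean_space \<Rightarrow> ereal) \<Rightarrow> 'a^'s \<Rightarrow> ereal" where
  "objective f r x = ereal (f x) + (\<Sum>i\<in>UNIV. r i (x $ i))"

definition regular_at ::
  "('s::finite \<Rightarrow> 'a::euclidean_space set) \<Rightarrow> ('a^'s \<Rightarrow> ereal) \<Rightarrow> 'a^'s \<Rightarrow> bool" where
  "regular_at E g x \<longleftrightarrow>
     (\<forall>d\<in>block_space E. (\<forall>i. 0 \<le> dir_deriv g x (axis i (d $ i))) \<longrightarrow> 0 \<le> dir_deriv g x d)"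

definition bregman :: "'a::euclidean_space set \<Rightarrow> ('a \<Rightarrow> real) \<Rightarrow> 'a \<Rightarrow> 'a \<Rightarrow> real" where
  "bregman S h u v = h u - h v - gradient_on S h v \<bullet> (u - v)"


section \<open>The algorithms\<close>

text \<open>
  Outer loops are numbered from \<open>1\<close>; \<open>xt k\<close> is the outer iterate and \<open>x k j\<close>, for
  \<open>j \<le> T k\<close>, the inner ones. The block chosen in inner iteration \<open>j \<ge> 1\<close> of outer loop \<open>k\<close> is
  \<open>blk k j\<close>. It is an arbitrary sequence, so every deterministic rule and every realisation of a
  random rule is covered. A parameter \<open>p k j\<close> belongs to the block \<open>blk k j\<close>.

  \<open>prev_val T blk xt x k j $ i\<close> is the value of block \<open>i\<close> before it was updated to
  \<open>x k j $ i\<close>. If block \<open>i\<close> has not been updated yet, it is that of \<open>xt 0\<close>, which coincides with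
  the outer iterate of index \<open>-1\<close>.
\<close>

fun prev_val ::
  "(nat \<Rightarrow> nat) \<Rightarrow> (nat \<Rightarrow> nat \<Rightarrow> 's::finite) \<Rightarrow> (nat \<Rightarrow> 'a^'s) \<Rightarrow> (nat \<Rightarrow> nat \<Rightarrow> 'a^'s)
     \<Rightarrow> nat \<Rightarrow> nat \<Rightarrow> 'a^'s" where
  "prev_val T blk xt x 0 j = xt 0"
| "prev_val T blk xt x (Suc k) 0 = prev_val T blk xt x k (T k)"
| "prev_val T blk xt x (Suc k) (Suc j) =
     block_upd (prev_val T blk xt x (Suc k) j) (blk (Suc k) (Suc j))
       (x (Suc k) j $ blk (Suc k) (Suc j))"

definition extrapolate ::
  "(nat \<Rightarrow> nat) \<Rightarrow> (nat \<Rightarrow> nat \<Rightarrow> 's::finite) \<Rightarrow> (nat \<Rightarrow> 'a::euclidean_space^'s)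
     \<Rightarrow> (nat \<Rightarrow> nat \<Rightarrow> 'a^'s) \<Rightarrow> (nat \<Rightarrow> nat \<Rightarrow> real) \<Rightarrow> nat \<Rightarrow> nat \<Rightarrow> 'a" where
  "extrapolate T blk xt x c k j =
     (let i = blk k j; u = x k (j - 1) $ i; y = prev_val T blk xt x k (j - 1) $ i
      in u + c k j *\<^sub>R (u - y))"

definition block_fun ::
  "('a^'s \<Rightarrow> real) \<Rightarrow> (nat \<Rightarrow> nat \<Rightarrow> 's::finite) \<Rightarrow> (nat \<Rightarrow> nat \<Rightarrow> 'a^'s) \<Rightarrow> nat \<Rightarrow> nat \<Rightarrow> 'a \<Rightarrow> real" where
  "block_fun f blk x k j u = f (block_upd (x k (j - 1)) (blk k j) u)"

definition block_scheme ::
  "('s::finite \<Rightarrow> 'a::euclidean_space set) \<Rightarrow> (nat \<Rightarrow> nat) \<Rightarrow> (nat \<Rightarrow> nat \<Rightarrow> 's)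
     \<Rightarrow> (nat \<Rightarrow> 'a^'s) \<Rightarrow> (nat \<Rightarrow> nat \<Rightarrow> 'a^'s) \<Rightarrow> bool" where
  "block_scheme E T blk xt x \<longleftrightarrow>
     xt 0 \<in> block_space E \<and>
     (\<forall>k\<ge>1. x k 0 = xt (k - 1) \<and> xt k = x k (T k) \<and>
        (\<forall>j\<in>{1..T k}. \<forall>i. i \<noteq> blk k j \<longrightarrow> x k j $ i = x k (j - 1) $ i))"

text \<open>
  In the two definitions below the argmin sets are nonempty, since they contain the iterates.
\<close>

definition IBP_iterates ::
  "('s::finite \<Rightarrow> 'a::euclidean_space set) \<Rightarrow> ('a^'s \<Rightarrow> real) \<Rightarrow> ('s \<Rightarrow> 'a \<Rightarrow> ereal) \<Rightarrow> ('s \<Rightarrow> 'a \<Rightarrow> real)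
     \<Rightarrow> (nat \<Rightarrow> nat) \<Rightarrow> (nat \<Rightarrow> nat \<Rightarrow> 's) \<Rightarrow> (nat \<Rightarrow> nat \<Rightarrow> real) \<Rightarrow> (nat \<Rightarrow> nat \<Rightarrow> real)
     \<Rightarrow> (nat \<Rightarrow> 'a^'s) \<Rightarrow> (nat \<Rightarrow> nat \<Rightarrow> 'a^'s) \<Rightarrow> bool" where
  "IBP_iterates E f r H T blk \<alpha> \<beta> xt x \<longleftrightarrow>
     block_scheme E T blk xt x \<and>
     (\<forall>k\<ge>1. \<forall>j\<in>{1..T k}.
        let i = blk k j; xhat = extrapolate T blk xt x \<alpha> k j
        in is_arg_min
             (\<lambda>u. ereal (block_fun f blk x k j u) + r i u + ereal (1 / \<beta> k j * bregman (E i) (H i) u xhat))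
             (\<lambda>u. u \<in> E i)
             (x k j $ i))"

definition IBPG_iterates ::
  "('s::finite \<Rightarrow> 'a::euclidean_space set) \<Rightarrow> ('a^'s \<Rightarrow> real) \<Rightarrow> ('s \<Rightarrow> 'a \<Rightarrow> ereal) \<Rightarrow> ('s \<Rightarrow> 'a \<Rightarrow> real)
     \<Rightarrow> (nat \<Rightarrow> nat) \<Rightarrow> (nat \<Rightarrow> nat \<Rightarrow> 's) \<Rightarrow> (nat \<Rightarrow> nat \<Rightarrow> real) \<Rightarrow> (nat \<Rightarrow> nat \<Rightarrow> real) \<Rightarrow> (nat \<Rightarrow> nat \<Rightarrow> real)
     \<Rightarrow> (nat \<Rightarrow> 'a^'s) \<Rightarrow> (nat \<Rightarrow> nat \<Rightarrow> 'a^'s) \<Rightarrow> bool" where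
  "IBPG_iterates E f r H T blk \<alpha> \<beta> \<gamma> xt x \<longleftrightarrow>
     block_scheme E T blk xt x \<and>
     (\<forall>k\<ge>1. \<forall>j\<in>{1..T k}.
        let i = blk k j; xhat = extrapolate T blk xt x \<alpha> k j; xgrave = extrapolate T blk xt x \<gamma> k j
        in is_arg_min
             (\<lambda>u. r i u + ereal (gradient_on (E i) (block_fun f blk x k j) xgrave \<bullet> u)
                    + ereal (1 / \<beta> k j * bregman (E i) (H i) u xhat))
             (\<lambda>u. u \<in> E i)
             (x k j $ i))"


section \<open>Assumptions on the problem and the parameters\<close>

definition updates_all_blocks :: "(nat \<Rightarrow> nat) \<Rightarrow> (nat \<Rightarrow> nat \<Rightarrow> 's::finite) \<Rightarrow> bool" where
  "updates_all_blocks T blk \<longleftrightarrow>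
     (\<exists>Tbar. \<forall>k\<ge>1. (\<forall>i. \<exists>j\<in>{1..T k}. blk k j = i) \<and> CARD('s) \<le> T k \<and> T k \<le> Tbar)"

definition kernel_assms ::
  "('s::finite \<Rightarrow> 'a::euclidean_space set) \<Rightarrow> ('s \<Rightarrow> 'a \<Rightarrow> real) \<Rightarrow> ('s \<Rightarrow> real) \<Rightarrow> ('s \<Rightarrow> real) \<Rightarrow> bool" where
  "kernel_assms E H \<sigma> LH \<longleftrightarrow>
     (\<forall>i. 0 < \<sigma> i \<and> strongly_convex_on (E i) (\<sigma> i) (H i) \<and> C1_on (E i) (H i) \<and>
          (LH i)-lipschitz_on (E i) (gradient_on (E i) (H i)))"

definition upd_count :: "(nat \<Rightarrow> nat \<Rightarrow> 's) \<Rightarrow> nat \<Rightarrow> nat \<Rightarrow> 's \<Rightarrow> nat" where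
  "upd_count blk k j i = card {l \<in> {1..j}. blk k l = i}"

text \<open>The number \<open>d_i^k\<close> of updates of block \<open>i\<close> in outer loop \<open>k\<close>.\<close>

definition num_upd :: "(nat \<Rightarrow> nat) \<Rightarrow> (nat \<Rightarrow> nat \<Rightarrow> 's) \<Rightarrow> nat \<Rightarrow> 's \<Rightarrow> nat" where
  "num_upd T blk k i = upd_count blk k (T k) i"

text \<open>
  The parameter used in the \<open>m\<close>-th update (\<open>m \<ge> 1\<close>) of block \<open>i\<close> in outer loop \<open>k\<close>, i.e. the
  barred version of \<open>p\<close>.
\<close>

definition at_upd :: "(nat \<Rightarrow> nat \<Rightarrow> 's) \<Rightarrow> (nat \<Rightarrow> nat \<Rightarrow> real) \<Rightarrow> 's \<Rightarrow> nat \<Rightarrow> nat \<Rightarrow> real" where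
  "at_upd blk p i k m = p k (THE j. 1 \<le> j \<and> blk k j = i \<and> upd_count blk k j i = m)"

text \<open>Extension of \<open>c i k m\<close> from \<open>1 \<le> m \<le> d_i^k\<close> to \<open>m = d_i^k + 1\<close>.\<close>

definition extend_upd ::
  "(nat \<Rightarrow> nat) \<Rightarrow> (nat \<Rightarrow> nat \<Rightarrow> 's) \<Rightarrow> ('s \<Rightarrow> nat \<Rightarrow> nat \<Rightarrow> real) \<Rightarrow> 's \<Rightarrow> nat \<Rightarrow> nat \<Rightarrow> real" where
  "extend_upd T blk c i k m = (if m \<le> num_upd T blk k i then c i k m else c i (k + 1) 1)"

definition theta ::
  "(nat \<Rightarrow> nat \<Rightarrow> 's) \<Rightarrow> ('s \<Rightarrow> real) \<Rightarrow> ('s \<Rightarrow> real) \<Rightarrow> real \<Rightarrow> (nat \<Rightarrow> nat \<Rightarrow> real) \<Rightarrow> (nat \<Rightarrow> nat \<Rightarrow> real)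
     \<Rightarrow> 's \<Rightarrow> nat \<Rightarrow> nat \<Rightarrow> real" where
  "theta blk \<sigma> LH \<nu> \<alpha> \<beta> i k m =
     (LH i * at_upd blk \<alpha> i k m)\<^sup>2 / (2 * \<nu> * \<sigma> i * at_upd blk \<beta> i k m)"

definition lambda_coeff ::
  "(nat \<Rightarrow> nat \<Rightarrow> 's) \<Rightarrow> ('s \<Rightarrow> real) \<Rightarrow> ('s \<Rightarrow> real) \<Rightarrow> real \<Rightarrow> real \<Rightarrow> (nat \<Rightarrow> nat \<Rightarrow> real)
     \<Rightarrow> (nat \<Rightarrow> nat \<Rightarrow> real) \<Rightarrow> (nat \<Rightarrow> nat \<Rightarrow> real) \<Rightarrow> 's \<Rightarrow> nat \<Rightarrow> nat \<Rightarrow> real" where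
  "lambda_coeff blk \<sigma> LH \<nu> \<kappa> \<alpha> \<gamma> L i k m =
     1 / 2 * (at_upd blk \<gamma> i k m + \<kappa> * LH i * at_upd blk \<alpha> i k m / \<sigma> i)\<^sup>2
       * (at_upd blk L i k m / (\<nu> * (\<kappa> - 1)))"

definition IBP_params ::
  "(nat \<Rightarrow> nat) \<Rightarrow> (nat \<Rightarrow> nat \<Rightarrow> 's::finite) \<Rightarrow> ('s \<Rightarrow> real) \<Rightarrow> ('s \<Rightarrow> real) \<Rightarrow> real \<Rightarrow> real
     \<Rightarrow> (nat \<Rightarrow> nat \<Rightarrow> real) \<Rightarrow> (nat \<Rightarrow> nat \<Rightarrow> real) \<Rightarrow> bool" where
  "IBP_params T blk \<sigma> LH \<nu> \<delta> \<alpha> \<beta> \<longleftrightarrow>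
     (\<forall>k\<ge>1. \<forall>j\<in>{1..T k}. 0 \<le> \<alpha> k j \<and> 0 < \<beta> k j) \<and>
     (\<forall>i. \<forall>k\<ge>1. \<forall>m\<in>{1..num_upd T blk k i}.
        (1 - \<nu>) * \<sigma> i / (2 * at_upd blk \<beta> i k m)
          \<ge> \<delta> * extend_upd T blk (theta blk \<sigma> LH \<nu> \<alpha> \<beta>) i k (m + 1))"

definition IBP_bounds ::
  "(nat \<Rightarrow> nat) \<Rightarrow> (nat \<Rightarrow> nat \<Rightarrow> 's::finite) \<Rightarrow> ('s \<Rightarrow> real) \<Rightarrow> ('s \<Rightarrow> real) \<Rightarrow> real
     \<Rightarrow> (nat \<Rightarrow> nat \<Rightarrow> real) \<Rightarrow> (nat \<Rightarrow> nat \<Rightarrow> real) \<Rightarrow> bool" where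
  "IBP_bounds T blk \<sigma> LH \<nu> \<alpha> \<beta> \<longleftrightarrow>
     (\<exists>W1>0. \<exists>\<alpha>max>0. \<exists>\<beta>min>0. \<forall>i. \<forall>k\<ge>1. \<forall>m\<in>{1..num_upd T blk k i}.
        W1 \<le> theta blk \<sigma> LH \<nu> \<alpha> \<beta> i k m \<and> at_upd blk \<alpha> i k m \<le> \<alpha>max \<and>
        \<beta>min \<le> at_upd blk \<beta> i k m)"

definition IBPG_params ::
  "('s::finite \<Rightarrow> 'a::euclidean_space set) \<Rightarrow> ('a^'s \<Rightarrow> real) \<Rightarrow> (nat \<Rightarrow> nat) \<Rightarrow> (nat \<Rightarrow> nat \<Rightarrow> 's)
     \<Rightarrow> (nat \<Rightarrow> nat \<Rightarrow> 'a^'s) \<Rightarrow> ('s \<Rightarrow> real) \<Rightarrow> ('s \<Rightarrow> real) \<Rightarrow> real \<Rightarrow> real \<Rightarrow> real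
     \<Rightarrow> (nat \<Rightarrow> nat \<Rightarrow> real) \<Rightarrow> (nat \<Rightarrow> nat \<Rightarrow> real) \<Rightarrow> (nat \<Rightarrow> nat \<Rightarrow> real) \<Rightarrow> (nat \<Rightarrow> nat \<Rightarrow> real) \<Rightarrow> bool" where
  "IBPG_params E f T blk x \<sigma> LH \<nu> \<delta> \<kappa> \<alpha> \<beta> \<gamma> L \<longleftrightarrow>
     (\<forall>k\<ge>1. \<forall>j\<in>{1..T k}. 0 \<le> \<alpha> k j \<and> 0 < \<beta> k j \<and> 0 \<le> \<gamma> k j \<and> 0 < L k j \<and>
        (L k j)-lipschitz_on (E (blk k j)) (gradient_on (E (blk k j)) (block_fun f blk x k j))) \<and>
     (\<forall>i. \<forall>k\<ge>1. \<forall>m\<in>{1..num_upd T blk k i}.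
        at_upd blk \<beta> i k m = \<sigma> i / (\<kappa> * at_upd blk L i k m) \<and>
        (1 - \<nu>) * (\<kappa> - 1) * at_upd blk L i k m / 2
          \<ge> \<delta> * extend_upd T blk (lambda_coeff blk \<sigma> LH \<nu> \<kappa> \<alpha> \<gamma> L) i k (m + 1))"

definition IBPG_bounds ::
  "(nat \<Rightarrow> nat) \<Rightarrow> (nat \<Rightarrow> nat \<Rightarrow> 's::finite) \<Rightarrow> ('s \<Rightarrow> real) \<Rightarrow> ('s \<Rightarrow> real) \<Rightarrow> real \<Rightarrow> real
     \<Rightarrow> (nat \<Rightarrow> nat \<Rightarrow> real) \<Rightarrow> (nat \<Rightarrow> nat \<Rightarrow> real) \<Rightarrow> (nat \<Rightarrow> nat \<Rightarrow> real) \<Rightarrow> bool" where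
  "IBPG_bounds T blk \<sigma> LH \<nu> \<kappa> \<alpha> \<gamma> L \<longleftrightarrow>
     (\<exists>W1>0. \<exists>Lmax>0. \<exists>\<alpha>max>0. \<exists>\<gamma>max>0. \<forall>i. \<forall>k\<ge>1. \<forall>m\<in>{1..num_upd T blk k i}.
        W1 \<le> lambda_coeff blk \<sigma> LH \<nu> \<kappa> \<alpha> \<gamma> L i k m \<and> at_upd blk L i k m \<le> Lmax \<and>
        at_upd blk \<alpha> i k m \<le> \<alpha>max \<and> at_upd blk \<gamma> i k m \<le> \<gamma>max)"

end

(*
  Every update decreases F by eta * |new step|^2 up to the term theta * |previous step|^2 of the same
  block, and eta >= delta * theta_next with delta > 1. Hence F plus the theta_next-weighted squares
  of the last steps of all blocks is a Lyapunov function, and it drops by a fixed multiple of the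
  squared step. A limit point z bounds it from below along a subsequence, by lower semicontinuity,
  and by monotonicity everywhere; so the steps tend to 0, and all inner iterates around the
  subsequence converge to z.

  Passing to the limit in the minimality of the update of block i gives
  r_i(z_i) <= r_i(u) + q_i(u) for all u, where q_i vanishes at z_i. Up to a multiple of the Bregman
  distance D_i(u, z_i) = o(|u - z_i|), q_i is the increment of f along block i (IBP) or its
  linearisation at z (IBPG). The former gives F'(z; d) >= 0 for block directions d. If f is C^1, then
  q_i has the partial gradient of f as derivative at z_i in both cases, which makes 0 a Frechet
  subgradient of F at z itself, so constant sequences witness the limiting subgradient.
*)
theory Submission
  imports Defs
begin

section \<open>Gradients on subspaces and Bregman distances\<close>

text \<open>The whole line through x in direction d stays in S, so the parameter set A is free: both
  \<open>at 0\<close> and \<open>at_right 0\<close> are available later.\<close>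

lemma has_derivative_on_line:
  assumes "subspace S" "x \<in> S" "d \<in> S" "(h has_derivative h') (at x within S)"
  shows "((\<lambda>t. h (x + t *\<^sub>R d)) has_derivative (\<lambda>t. h' (t *\<^sub>R d))) (at (0::real) within A)"
proof -
  have "range (\<lambda>t. x + t *\<^sub>R d) \<subseteq> S"
    using assms by (auto intro: subspace_add subspace_scale)
  then have "(h has_derivative h') (at (x + 0 *\<^sub>R d) within (\<lambda>t. x + t *\<^sub>R d) ` A)"
    using has_derivative_subset[OF assms(4), of "(\<lambda>t. x + t *\<^sub>R d) ` A"] by auto
  moreover have "((\<lambda>t. x + t *\<^sub>R d) has_derivative (\<lambda>t. t *\<^sub>R d)) (at 0 within A)"
    by (auto intro!: derivative_eq_intros)
  ultimately show ?thesis
    using has_derivative_in_compose by blast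
qed

text \<open>Two candidates have the same derivative along the direction \<open>g' - g\<close>, which
  lies in S because both do; hence \<open>g' - g\<close> is orthogonal to itself.\<close>

lemma gradient_on_unique:
  assumes "subspace S" "x \<in> S" "g \<in> S" "(h has_derivative (\<lambda>v. g \<bullet> v)) (at x within S)"
  shows "gradient_on S h x = g"
  unfolding gradient_on_def
proof (rule the_equality)
  fix g' assume g': "g' \<in> S \<and> (h has_derivative (\<lambda>v. g' \<bullet> v)) (at x within S)"
  have d: "g' - g \<in> S" using assms g' by (auto intro: subspace_diff)
  have "(\<lambda>t. g' \<bullet> (t *\<^sub>R (g' - g))) = (\<lambda>t. g \<bullet> (t *\<^sub>R (g' - g)))"
    using g' assms(4)
    by (intro has_derivative_unique[of "\<lambda>t. h (x + t *\<^sub>R (g' - g))" _ 0]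
        has_derivative_on_line[OF assms(1,2) d]) auto
  then have "g' \<bullet> (g' - g) = g \<bullet> (g' - g)" by (metis scaleR_one)
  then have "(g' - g) \<bullet> (g' - g) = 0" by (simp add: inner_diff_left)
  then show "g' = g" by simp
qed (use assms in auto)

text \<open>The Riesz vector \<open>adjoint h' 1\<close> of a derivative splits into a part in S and
  a part orthogonal to S. On S only the first part acts, and a limit within S tests no other
  directions.\<close>

lemma gradient_on:
  fixes h :: "'b::euclidean_space \<Rightarrow> real"
  assumes S: "subspace S" and x: "x \<in> S" and h: "h differentiable_on S"
  shows gradient_on_mem: "gradient_on S h x \<in> S"
    and has_derivative_gradient_on:
      "(h has_derivative (\<lambda>v. gradient_on S h x \<bullet> v)) (at x within S)"
proof -
  obtain h' where h': "(h has_derivative h') (at x within S)"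
    using h x unfolding differentiable_on_def differentiable_def by blast
  then have lin: "linear h'" by (rule has_derivative_linear)
  obtain g w where g: "g \<in> span S" "\<And>v. v \<in> span S \<Longrightarrow> orthogonal w v" "adjoint h' 1 = g + w"
    using orthogonal_subspace_decomp_exists by metis
  have eq: "h' v = g \<bullet> v" if "v \<in> S" for v
    using adjoint_works[OF lin, of v 1] g that
    by (simp add: inner_commute inner_add_right orthogonal_def span_base)
  have "(h has_derivative (\<lambda>v. g \<bullet> v)) (at x within S)"
    unfolding has_derivative_within
  proof
    have "((\<lambda>y. (1 / norm (y - x)) *\<^sub>R (h y - (h x + h' (y - x)))) \<longlongrightarrow> 0) (at x within S)"
      using h' by (simp add: has_derivative_within)
    then show "((\<lambda>y. (1 / norm (y - x)) *\<^sub>R (h y - (h x + g \<bullet> (y - x)))) \<longlongrightarrow> 0) (at x within S)"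
      by (rule Lim_transform_within[OF _ zero_less_one]) (simp add: eq x S subspace_diff)
  qed (rule bounded_linear_inner_right)
  moreover have "g \<in> S" using g S by (simp add: span_eq_iff[THEN iffD2])
  ultimately show "gradient_on S h x \<in> S"
    "(h has_derivative (\<lambda>v. gradient_on S h x \<bullet> v)) (at x within S)"
    using gradient_on_unique[OF S x] by auto
qed

lemma has_derivative_imp_diff_quotient_within:
  assumes "(h has_derivative (\<lambda>v. 0)) (at x within S)"
  shows "((\<lambda>y. (h y - h x) / norm (y - x)) \<longlongrightarrow> (0::real)) (at x within S)"
  using assms unfolding has_derivative_within by (simp add: field_simps)

lemma has_derivative_imp_diff_quotient_line:
  fixes h :: "'b::euclidean_space \<Rightarrow> real"
  assumes "subspace S" "x \<in> S" "d \<in> S" "(h has_derivative h') (at x within S)"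
  shows "((\<lambda>t. (h (x + t *\<^sub>R d) - h x) / t) \<longlongrightarrow> h' d) (at_right 0)"
proof -
  have "h' (t *\<^sub>R d) = h' d * t" for t
    using has_derivative_linear[OF assms(4)] by (simp add: linear_cmul)
  with has_derivative_on_line[OF assms, where A = "{0<..}"]
  have "((\<lambda>t. h (x + t *\<^sub>R d)) has_field_derivative h' d) (at_right 0)"
    by (simp add: has_field_derivative_def)
  then show ?thesis by (simp add: has_field_derivative_iff)
qed

text \<open>The three-point identity of Bregman distances.\<close>

lemma bregman_diff:
  "bregman S h u v - bregman S h w v
     = bregman S h u w + (gradient_on S h w - gradient_on S h v) \<bullet> (u - w)"
  by (simp add: bregman_def inner_diff_left inner_diff_right)

text \<open>Strong convexity on the segment bounds the difference quotient at v in direction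
  \<open>u - v\<close>; letting the step t decrease to 0 replaces the quotient by the gradient
  term.\<close>

lemma bregman_ge:
  fixes h :: "'b::euclidean_space \<Rightarrow> real"
  assumes S: "subspace S" and uv: "u \<in> S" "v \<in> S" and h: "h differentiable_on S"
    and sc: "strongly_convex_on S \<sigma> h"
  shows "\<sigma> / 2 * (norm (u - v))\<^sup>2 \<le> bregman S h u v"
proof -
  have "((\<lambda>t. (h (v + t *\<^sub>R (u - v)) - h v) / t) \<longlongrightarrow> gradient_on S h v \<bullet> (u - v)) (at_right 0)"
    using has_derivative_imp_diff_quotient_line[OF S uv(2) _ has_derivative_gradient_on[OF S uv(2) h]] S uv
    by (simp add: subspace_diff)
  moreover have "((\<lambda>t. h u - h v - \<sigma> / 2 * (1 - t) * (norm (u - v))\<^sup>2) \<longlongrightarrow>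
      h u - h v - \<sigma> / 2 * (1 - 0) * (norm (u - v))\<^sup>2) (at_right 0)"
    by (intro tendsto_intros)
  moreover have "\<forall>\<^sub>F t in at_right 0. (h (v + t *\<^sub>R (u - v)) - h v) / t
      \<le> h u - h v - \<sigma> / 2 * (1 - t) * (norm (u - v))\<^sup>2"
  proof -
    have "(h (v + t *\<^sub>R (u - v)) - h v) / t \<le> h u - h v - \<sigma> / 2 * (1 - t) * (norm (u - v))\<^sup>2"
      if t: "0 < t" "t < 1" for t
    proof -
      have "h (v + t *\<^sub>R (u - v)) = h (t *\<^sub>R u + (1 - t) *\<^sub>R v)" by (simp add: algebra_simps)
      also have "\<dots> \<le> t * h u + (1 - t) * h v - \<sigma> / 2 * t * (1 - t) * (norm (u - v))\<^sup>2"
        using sc uv t unfolding strongly_convex_on_def by simp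
      finally have "h (v + t *\<^sub>R (u - v)) - h v
          \<le> t * (h u - h v - \<sigma> / 2 * (1 - t) * (norm (u - v))\<^sup>2)"
        by (simp add: algebra_simps)
      with t show ?thesis by (simp add: pos_divide_le_eq mult.commute)
    qed
    then show ?thesis by (auto simp: eventually_at_right_field intro!: exI[of _ 1])
  qed
  ultimately have "gradient_on S h v \<bullet> (u - v) \<le> h u - h v - \<sigma> / 2 * (1 - 0) * (norm (u - v))\<^sup>2"
    by (intro tendsto_le[of "at_right 0"]) auto
  then show ?thesis by (simp add: bregman_def)
qed

text \<open>Along the segment from v to u, the function \<open>w\<close>, which is h minus the
  linear and quadratic terms of the bound, has nonpositive derivative by Cauchy-Schwarz and the
  Lipschitz estimate. Comparing its values at 0 and 1 gives the claim without integration.\<close>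

lemma descent_lemma:
  fixes h :: "'b::euclidean_space \<Rightarrow> real"
  assumes S: "subspace S" and uv: "u \<in> S" "v \<in> S" and h: "h differentiable_on S"
    and lip: "L-lipschitz_on S (gradient_on S h)"
  shows "h u \<le> h v + gradient_on S h v \<bullet> (u - v) + L / 2 * (norm (u - v))\<^sup>2"
proof -
  define d where "d = u - v"
  define p where "p t = v + t *\<^sub>R d" for t
  define g where "g t = gradient_on S h (p t)" for t
  define w where "w t = h (p t) - t * (g 0 \<bullet> d) - L / 2 * t\<^sup>2 * (norm d)\<^sup>2" for t
  have d: "d \<in> S" using S uv by (simp add: d_def subspace_diff)
  have p: "p t \<in> S" for t using S uv d by (simp add: p_def subspace_add subspace_scale)
  have "\<exists>y. (w has_real_derivative y) (at t) \<and> y \<le> 0" if "0 \<le> t" for t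
  proof (intro exI conjI)
    \<comment> \<open>The rule for lines differentiates at parameter 0 only, so the line is
      restarted at \<open>p t\<close> and the result is shifted to t.\<close>
    have "((\<lambda>s. h (p t + s *\<^sub>R d)) has_derivative (\<lambda>s. g t \<bullet> (s *\<^sub>R d))) (at 0)"
      unfolding g_def
      by (intro has_derivative_on_line[OF S p d] has_derivative_gradient_on[OF S p h])
    then have "((\<lambda>s. h (p (s + t))) has_field_derivative g t \<bullet> d) (at 0)"
      by (simp add: has_field_derivative_def p_def algebra_simps mult_commute_abs)
    then have "((\<lambda>s. h (p s)) has_field_derivative g t \<bullet> d) (at t)"
      using DERIV_shift[of "\<lambda>s. h (p s)" _ 0 t] by simp
    then show "(w has_real_derivative g t \<bullet> d - g 0 \<bullet> d - L * t * (norm d)\<^sup>2) (at t)"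
      unfolding w_def by (auto intro!: derivative_eq_intros)
    have "g t \<bullet> d - g 0 \<bullet> d \<le> norm (g t - g 0) * norm d"
      by (metis inner_diff_left norm_cauchy_schwarz)
    also have "\<dots> \<le> (L * dist (p t) (p 0)) * norm d"
      using lipschitz_onD[OF lip p p] by (intro mult_right_mono) (auto simp: g_def dist_norm)
    also have "\<dots> = L * t * (norm d)\<^sup>2" using that by (simp add: p_def dist_norm power2_eq_square)
    finally show "g t \<bullet> d - g 0 \<bullet> d - L * t * (norm d)\<^sup>2 \<le> 0" by simp
  qed
  then have "w 1 \<le> w 0" by (intro DERIV_nonpos_imp_nonincreasing[of 0 1 w]) auto
  then show ?thesis by (simp add: w_def g_def p_def d_def)
qed

text \<open>Serves to absorb the cross term of previous and new step: \<epsilon> will be the share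
  \<nu> of the available curvature, and the remainder becomes the coefficient of the previous
  step.\<close>

lemma young_inequality:
  fixes p b \<epsilon> :: real
  assumes "0 < \<epsilon>"
  shows "p * b \<le> \<epsilon> / 2 * b\<^sup>2 + p\<^sup>2 / (2 * \<epsilon>)"
proof -
  have "0 \<le> (\<epsilon> * b - p)\<^sup>2 / (2 * \<epsilon>)" using assms by simp
  also have "\<dots> = \<epsilon> / 2 * b\<^sup>2 + p\<^sup>2 / (2 * \<epsilon>) - p * b"
    using assms by (simp add: field_simps power2_eq_square)
  finally show ?thesis by simp
qed

text \<open>The extrapolated centre has distance \<open>c * norm (w - y)\<close> from w. By the
  three-point identity, inertia therefore costs only a cross term between the previous step
  \<open>w - y\<close> and the new step \<open>u - w\<close>.\<close>

lemma bregman_inertial_ge: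
  fixes h :: "'b::euclidean_space \<Rightarrow> real"
  assumes S: "subspace S" and mem: "u \<in> S" "w \<in> S" "y \<in> S" and h: "h differentiable_on S"
    and sc: "strongly_convex_on S \<sigma> h" and lip: "L-lipschitz_on S (gradient_on S h)" and c: "0 \<le> c"
  shows "\<sigma> / 2 * (norm (u - w))\<^sup>2 - L * c * norm (w - y) * norm (u - w)
    \<le> bregman S h u (w + c *\<^sub>R (w - y)) - bregman S h w (w + c *\<^sub>R (w - y))"
proof -
  define v where "v = w + c *\<^sub>R (w - y)"
  have v: "v \<in> S" using S mem by (simp add: v_def subspace_add subspace_diff subspace_scale)
  have "\<bar>(gradient_on S h w - gradient_on S h v) \<bullet> (u - w)\<bar> \<le> norm (gradient_on S h w - gradient_on S h v) * norm (u - w)"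
    by (rule Cauchy_Schwarz_ineq2)
  also have "\<dots> \<le> (L * dist w v) * norm (u - w)"
    using lipschitz_onD[OF lip mem(2) v] by (intro mult_right_mono) (auto simp: dist_norm)
  also have "dist w v = c * norm (w - y)" using c by (simp add: v_def dist_norm)
  finally have "\<bar>(gradient_on S h w - gradient_on S h v) \<bullet> (u - w)\<bar> \<le> L * c * norm (w - y) * norm (u - w)"
    by (simp add: mult.assoc)
  then show ?thesis
    using bregman_diff[of S h u v w] bregman_ge[OF S mem(1,2) h sc] unfolding v_def by linarith
qed

lemma continuous_on_bregman:
  assumes "C1_on S h"
  shows "continuous_on S (bregman S h u)"
proof -
  have "continuous_on S h" "continuous_on S (gradient_on S h)"
    using assms by (auto simp: C1_on_def differentiable_imp_continuous_on)
  then show ?thesis unfolding bregman_def by (intro continuous_intros)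
qed

text \<open>The gradient of h at v cancels against the linear term. Hence the proximal term leaves
  no trace in the first-order conditions at a limit point, whatever its coefficient.\<close>

lemma has_derivative_bregman:
  fixes h :: "'b::euclidean_space \<Rightarrow> real"
  assumes "subspace S" "v \<in> S" "h differentiable_on S"
  shows "((\<lambda>u. bregman S h u v) has_derivative (\<lambda>_. 0)) (at v within S)"
  unfolding bregman_def
  by (auto intro!: derivative_eq_intros has_derivative_gradient_on[OF assms])

lemma has_derivative_scaled_bregman:
  fixes h :: "'b::euclidean_space \<Rightarrow> real"
  assumes "subspace S" "v \<in> S" "h differentiable_on S"
  shows "((\<lambda>u. c * bregman S h u v) has_derivative (\<lambda>_. 0)) (at v within S)"
  using has_derivative_mult_right[OF has_derivative_bregman[OF assms], of c] by simp

lemma bregman_self [simp]: "bregman S h v v = 0"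
  by (simp add: bregman_def)

text \<open>The differences \<open>U n - Y n\<close> tend to 0, so the coefficients only have to
  stay bounded; they may oscillate.\<close>

lemma tendsto_extrapolated:
  fixes U Y :: "nat \<Rightarrow> 'b::real_normed_vector"
  assumes "U \<longlonglongrightarrow> z" "Y \<longlonglongrightarrow> z" "\<And>n. \<bar>c n\<bar> \<le> M"
  shows "(\<lambda>n. U n + c n *\<^sub>R (U n - Y n)) \<longlonglongrightarrow> z"
proof -
  have "(\<lambda>n. U n - Y n) \<longlonglongrightarrow> 0" using tendsto_diff[OF assms(1,2)] by simp
  then have "(\<lambda>n. M * norm (U n - Y n)) \<longlonglongrightarrow> 0"
    by (intro tendsto_mult_right_zero tendsto_norm_zero)
  moreover have "\<forall>\<^sub>F n in sequentially. norm (c n *\<^sub>R (U n - Y n)) \<le> M * norm (U n - Y n)"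
    using assms(3) by (simp add: mult_right_mono)
  ultimately have "(\<lambda>n. c n *\<^sub>R (U n - Y n)) \<longlonglongrightarrow> 0" by (rule Lim_null_comparison[rotated])
  from tendsto_add[OF assms(1) this] show ?thesis by simp
qed

section \<open>Block structure and critical points\<close>

lemma subspace_block_space:
  assumes "\<And>i. subspace (E i)"
  shows "subspace (block_space E)"
  using assms unfolding subspace_def block_space_def by simp

lemma block_upd_mem:
  "y \<in> block_space E \<Longrightarrow> u \<in> E i \<Longrightarrow> block_upd y i u \<in> block_space E"
  by (simp add: block_space_def block_upd_def)

lemma block_upd_eq: "block_upd y i (u::'a::real_vector) = y + axis i (u - y $ i)"
  by (auto simp: block_upd_def axis_def vec_eq_iff)

lemma block_upd_nth: "block_upd y i u $ l = (if l = i then u else y $ l)"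
  by (simp add: block_upd_def)

lemma block_upd_self [simp]: "block_upd y i (y $ i) = y"
  by (simp add: vec_eq_iff block_upd_nth)

lemma linear_axis: "linear (axis i :: 'a::real_vector \<Rightarrow> 'a^'s)"
  by (auto intro!: linearI simp: axis_def vec_eq_iff)

lemma has_derivative_block_upd:
  fixes y :: "'a::euclidean_space^'s"
  shows "(block_upd y i has_derivative axis i) (at u within A)"
proof -
  have "bounded_linear (axis i :: 'a \<Rightarrow> 'a^'s)"
    using linear_axis by (rule linear_conv_bounded_linear[THEN iffD1])
  moreover have "((\<lambda>u. u - y $ i) has_derivative (\<lambda>v. v)) (at u within A)"
    by (auto intro!: derivative_eq_intros)
  ultimately have "((\<lambda>u. axis i (u - y $ i)) has_derivative axis i) (at u within A)"
    by (rule bounded_linear.has_derivative)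
  from has_derivative_add[OF has_derivative_const this]
  have "((\<lambda>u. y + axis i (u - y $ i)) has_derivative axis i) (at u within A)"
    by simp
  then show ?thesis by (simp add: block_upd_eq[abs_def])
qed

lemma tendsto_block_upd:
  assumes "(Y \<longlongrightarrow> y) F" "(U \<longlongrightarrow> u) F"
  shows "((\<lambda>n. block_upd (Y n) i (U n)) \<longlongrightarrow> block_upd y i u) F"
proof (rule vec_tendstoI)
  show "((\<lambda>n. block_upd (Y n) i (U n) $ l) \<longlongrightarrow> block_upd y i u $ l) F" for l
    using assms by (cases "l = i") (simp_all add: block_upd_nth tendsto_vec_nth)
qed

lemma has_derivative_block_fun:
  fixes f :: "'a::euclidean_space^'s::finite \<Rightarrow> real"
  assumes "\<And>i. subspace (E i)" "f differentiable_on block_space E" "y \<in> block_space E" "u \<in> E i"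
  shows "((\<lambda>u. f (block_upd y i u)) has_derivative
     (\<lambda>v. gradient_on (block_space E) f (block_upd y i u) $ i \<bullet> v)) (at u within E i)"
proof -
  have "(f has_derivative (\<lambda>v. gradient_on (block_space E) f (block_upd y i u) \<bullet> v))
      (at (block_upd y i u) within block_upd y i ` E i)"
    using assms
    by (intro has_derivative_subset[OF has_derivative_gradient_on] subspace_block_space)
      (auto intro: block_upd_mem)
  from has_derivative_in_compose[OF has_derivative_block_upd this] show ?thesis
    by (simp add: inner_axis)
qed

text \<open>The block functions change in every iteration; expressing their gradients through the
  single continuous gradient of f is what allows a passage to the limit.\<close>

lemma gradient_on_block_fun:
  fixes f :: "'a::euclidean_space^'s::finite \<Rightarrow> real"
  assumes "\<And>i. subspace (E i)" "f differentiable_on block_space E" "y \<in> block_space E" "u \<in> E i"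
  shows "gradient_on (E i) (\<lambda>u. f (block_upd y i u)) u
    = gradient_on (block_space E) f (block_upd y i u) $ i"
proof (rule gradient_on_unique)
  have "gradient_on (block_space E) f (block_upd y i u) \<in> block_space E"
    using assms by (intro gradient_on_mem subspace_block_space block_upd_mem)
  then show "gradient_on (block_space E) f (block_upd y i u) $ i \<in> E i"
    by (simp add: block_space_def)
qed (use assms in \<open>auto intro: has_derivative_block_fun\<close>)

section \<open>Lower limits and lower semicontinuity\<close>

lemma Liminf_nonnegI:
  fixes X :: "_ \<Rightarrow> ereal"
  assumes "(h \<longlongrightarrow> (0::real)) F" "\<forall>\<^sub>F y in F. ereal (h y) \<le> X y"
  shows "0 \<le> Liminf F X"
  unfolding le_Liminf_iff
proof (intro allI impI)
  fix a :: ereal assume "a < 0"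
  moreover have "((\<lambda>y. ereal (h y)) \<longlongrightarrow> 0) F"
    using assms(1) by (simp add: zero_ereal_def)
  ultimately have "\<forall>\<^sub>F y in F. a < ereal (h y)" by (rule order_tendstoD(1)[rotated])
  with assms(2) show "\<forall>\<^sub>F y in F. a < X y" by eventually_elim simp
qed

text \<open>The filter in \<open>lsc_on\<close> is punctured; members of X that equal u are covered
  by \<open>a < g u\<close> itself.\<close>

lemma lsc_on_eventually_less:
  assumes "lsc_on S g" "u \<in> S" "a < g u" "(X \<longlongrightarrow> u) F" "\<forall>\<^sub>F n in F. X n \<in> S"
  shows "\<forall>\<^sub>F n in F. a < g (X n)"
proof -
  have "a < Liminf (at u within S) g" using assms(1-3) by (auto simp: lsc_on_def)
  then have "\<forall>\<^sub>F y in at u within S. a < g y" by (rule less_LiminfD)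
  then have "\<forall>\<^sub>F y in nhds u. y \<in> S \<longrightarrow> a < g y"
    unfolding eventually_at_filter by eventually_elim (use assms in auto)
  then have "\<forall>\<^sub>F n in F. X n \<in> S \<longrightarrow> a < g (X n)"
    using assms(4) by (auto simp: filterlim_def le_filter_def eventually_filtermap)
  with assms(5) show ?thesis by eventually_elim simp
qed

text \<open>The block inequalities are added up. The values \<open>r i (z $ i)\<close> are finite
  and can be moved to the other side, whereas \<open>r i (y $ i)\<close> may be infinite.\<close>

lemma objective_diff_ge:
  assumes "z \<in> block_space E" "y \<in> block_space E" "\<And>i. \<bar>r i (z $ i)\<bar> \<noteq> \<infinity>"
    and key: "\<And>i u. u \<in> E i \<Longrightarrow> r i (z $ i) \<le> r i u + ereal (q i u)"
  shows "ereal (f y - f z - (\<Sum>i\<in>UNIV. q i (y $ i))) \<le> objective f r y - objective f r z"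
proof -
  define \<rho> where "\<rho> i = real_of_ereal (r i (z $ i))" for i
  have \<rho>: "r i (z $ i) = ereal (\<rho> i)" for i
    using assms(3)[of i] by (simp add: \<rho>_def ereal_real)
  have "ereal (\<rho> i - q i (y $ i)) \<le> r i (y $ i)" for i
    using key[of "y $ i" i] assms(2) unfolding \<rho> block_space_def
    by (cases "r i (y $ i)") auto
  then have "(\<Sum>i\<in>UNIV. ereal (\<rho> i - q i (y $ i))) \<le> (\<Sum>i\<in>UNIV. r i (y $ i))"
    by (intro sum_mono)
  then have "ereal (f y) + ereal (\<Sum>i\<in>UNIV. \<rho> i - q i (y $ i)) - ereal (f z + (\<Sum>i\<in>UNIV. \<rho> i))
      \<le> objective f r y - objective f r z"
    unfolding objective_def \<rho> by (intro ereal_minus_mono add_mono) auto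
  then show ?thesis by (simp add: sum_subtractf algebra_simps)
qed

section \<open>From block inequalities to critical points\<close>

lemma edom_objective_iff:
  assumes "\<And>i. proper_on (E i) (r i)" "z \<in> block_space E"
  shows "z \<in> edom (block_space E) (objective f r) \<longleftrightarrow> (\<forall>i. \<bar>r i (z $ i)\<bar> \<noteq> \<infinity>)"
proof -
  have "r i (z $ i) \<noteq> -\<infinity>" for i
    using assms by (auto simp: proper_on_def block_space_def)
  then have "\<bar>r i (z $ i)\<bar> \<noteq> \<infinity> \<longleftrightarrow> r i (z $ i) \<noteq> \<infinity>" for i
    by (cases "r i (z $ i)") auto
  then show ?thesis
    using assms(2) by (simp add: edom_def objective_def sum_Pinfty)
qed

text \<open>The blocks of G sum up to G, so \<open>R\<close>, which is f minus all majorants, has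
  derivative 0 at z. The increment of the objective dominates that of \<open>R\<close> and thus has
  a nonnegative lower limit after division by \<open>norm (y - z)\<close>.\<close>

lemma critical_type_II_if_block_majorants:
  fixes f :: "'a::euclidean_space^'s::finite \<Rightarrow> real"
  assumes S: "\<And>i. subspace (E i)" and z: "z \<in> block_space E" "\<And>i. \<bar>r i (z $ i)\<bar> \<noteq> \<infinity>"
    and dom: "z \<in> edom (block_space E) (objective f r)"
    and f: "(f has_derivative (\<lambda>v. G \<bullet> v)) (at z within block_space E)"
    and key: "\<And>i u. u \<in> E i \<Longrightarrow> r i (z $ i) \<le> r i u + ereal (q i u)"
    and q: "\<And>i. q i (z $ i) = 0" "\<And>i. (q i has_derivative (\<lambda>v. G $ i \<bullet> v)) (at (z $ i) within E i)"
  shows "critical_type_II (block_space E) (objective f r) z"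
proof -
  define R where "R y = f y - (\<Sum>i\<in>UNIV. q i (y $ i))" for y
  have q': "((\<lambda>y. q i (y $ i)) has_derivative (\<lambda>v. G $ i \<bullet> (v $ i))) (at z within block_space E)" for i
    by (rule has_derivative_in_compose[where f = "\<lambda>y. y $ i"])
      (auto intro!: derivative_eq_intros bounded_linear_imp_has_derivative bounded_linear_vec_nth
        has_derivative_subset[OF q(2)] simp: block_space_def)
  have "(R has_derivative (\<lambda>v. G \<bullet> v - (\<Sum>i\<in>UNIV. G $ i \<bullet> (v $ i)))) (at z within block_space E)"
    unfolding R_def by (intro derivative_intros f q')
  then have "(R has_derivative (\<lambda>v. 0)) (at z within block_space E)"
    by (simp add: inner_vec_def)
  then have lim: "((\<lambda>y. (R y - R z) / norm (y - z)) \<longlongrightarrow> 0) (at z within block_space E)"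
    by (rule has_derivative_imp_diff_quotient_within)
  have "ereal ((R y - R z) / norm (y - z))
      \<le> (objective f r y - objective f r z - ereal (0 \<bullet> (y - z))) / ereal (norm (y - z))"
    if "y \<in> block_space E" "y \<noteq> z" for y
  proof -
    have "ereal (R y - R z) \<le> objective f r y - objective f r z"
      using objective_diff_ge[where f = f and r = r and q = q and E = E, OF z(1) that(1) z(2) key]
      by (simp add: R_def q algebra_simps)
    from ereal_divide_right_mono[OF this, of "ereal (norm (y - z))"] that show ?thesis by simp
  qed
  then have "0 \<le> Liminf (at z within block_space E) (\<lambda>y. (objective f r y - objective f r z
      - ereal (0 \<bullet> (y - z))) / ereal (norm (y - z)))"
    by (intro Liminf_nonnegI[OF lim]) (auto simp: eventually_at_filter)
  moreover have "0 \<in> block_space E" using S by (simp add: block_space_def subspace_0)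
  ultimately have "0 \<in> frechet_subdiff (block_space E) (objective f r) z"
    using dom by (simp add: frechet_subdiff_def)
  then have "0 \<in> limiting_subdiff (block_space E) (objective f r) z"
    using dom \<open>0 \<in> block_space E\<close> unfolding limiting_subdiff_def
    by (intro CollectI conjI exI[of _ "\<lambda>_. z"] exI[of _ "\<lambda>_. 0"]) auto
  with dom show ?thesis by (simp add: critical_type_II_def)
qed

text \<open>For non-smooth f no derivative is available, but along a single block the increment of f
  cancels exactly against the one in the majorant. Only \<open>p i\<close> is left, which is of
  smaller order than t; regularity then extends the inequality to all directions.\<close>

lemma critical_type_I_if_block_majorants:
  fixes f :: "'a::euclidean_space^'s::finite \<Rightarrow> real"
  assumes S: "\<And>i. subspace (E i)" and z: "z \<in> block_space E" "\<And>i. \<bar>r i (z $ i)\<bar> \<noteq> \<infinity>"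
    and dom: "z \<in> edom (block_space E) (objective f r)"
    and reg: "regular_at E (objective f r) z"
    and key: "\<And>i u. u \<in> E i \<Longrightarrow> r i (z $ i) \<le> r i u + ereal (f (block_upd z i u) - f z + p i u)"
    and p: "\<And>i. p i (z $ i) = 0" "\<And>i. (p i has_derivative (\<lambda>v. 0)) (at (z $ i) within E i)"
  shows "critical_type_I (block_space E) (objective f r) z"
proof -
  have "0 \<le> dir_deriv (objective f r) z (axis i (d $ i))" if d: "d \<in> block_space E" for d i
  proof -
    have zd: "z $ i \<in> E i" "d $ i \<in> E i" using z d by (auto simp: block_space_def)
    have lim: "((\<lambda>t. - ((p i (z $ i + t *\<^sub>R d $ i) - p i (z $ i)) / t)) \<longlongrightarrow> 0) (at_right 0)"
      using tendsto_minus[OF has_derivative_imp_diff_quotient_line[OF S zd p(2)]] by simp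
    have "ereal (- ((p i (z $ i + t *\<^sub>R d $ i) - p i (z $ i)) / t))
        \<le> (objective f r (z + t *\<^sub>R axis i (d $ i)) - objective f r z) / ereal t" if t: "t > 0" for t
    proof -
      define y where "y = block_upd z i (z $ i + t *\<^sub>R d $ i)"
      have y: "z + t *\<^sub>R axis i (d $ i) = y"
        by (simp add: y_def block_upd_eq linear_cmul[OF linear_axis])
      have "y \<in> block_space E"
        using z zd S unfolding y_def by (intro block_upd_mem subspace_add subspace_scale)
      \<comment> \<open>For l other than i, the block \<open>y $ l\<close> is that of z, so both
        parts of the summand vanish.\<close>
      moreover have "(\<Sum>l\<in>UNIV. f (block_upd z l (y $ l)) - f z + p l (y $ l))
          = f y - f z + p i (y $ i)"
      proof -
        have "f (block_upd z l (y $ l)) - f z + p l (y $ l) = 0" if "l \<noteq> i" for l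
          using that by (simp add: y_def block_upd_nth p)
        then have "(\<Sum>l\<in>UNIV. f (block_upd z l (y $ l)) - f z + p l (y $ l))
            = (\<Sum>l\<in>{i}. f (block_upd z l (y $ l)) - f z + p l (y $ l))"
          by (intro sum.mono_neutral_right) auto
        then show ?thesis by (simp add: y_def block_upd_nth)
      qed
      ultimately have "ereal (- (p i (y $ i) - p i (z $ i))) \<le> objective f r y - objective f r z"
        using objective_diff_ge[where f = f and r = r and E = E and y = y
            and q = "\<lambda>i u. f (block_upd z i u) - f z + p i u", OF z(1) _ z(2) key]
        by (simp add: p)
      from ereal_divide_right_mono[OF this, of "ereal t"] t show ?thesis
        unfolding y by (simp add: y_def block_upd_nth minus_divide_left)
    qed
    then show ?thesis
      unfolding dir_deriv_def
      by (intro Liminf_nonnegI[OF lim]) (auto simp: eventually_at_filter)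
  qed
  with reg dom show ?thesis
    unfolding critical_type_I_def regular_at_def by blast
qed

section \<open>Descent for inertial block schemes\<close>

lemma upd_count_Suc:
  "upd_count blk k (Suc j) i = upd_count blk k j i + (if blk k (Suc j) = i then 1 else 0)"
proof -
  have "{l \<in> {1..Suc j}. blk k l = i}
      = (if blk k (Suc j) = i then insert (Suc j) {l \<in> {1..j}. blk k l = i} else {l \<in> {1..j}. blk k l = i})"
    by (auto simp: le_Suc_eq)
  then show ?thesis by (simp add: upd_count_def)
qed

lemma upd_count_mono: "j \<le> j' \<Longrightarrow> upd_count blk k j i \<le> upd_count blk k j' i"
  unfolding upd_count_def by (intro card_mono) auto

lemma upd_count_less:
  assumes "j < j'" "blk k j' = i"
  shows "upd_count blk k j i < upd_count blk k j' i"
proof -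
  obtain l where l: "j' = Suc l" using assms(1) by (cases j') auto
  with assms show ?thesis using upd_count_mono[of j l blk k i] by (simp add: upd_count_Suc)
qed

text \<open>The counter of block i grows strictly at each of its updates, so the description in
  \<open>at_upd\<close> determines j. This translates conditions indexed by update number into
  conditions indexed by inner iteration.\<close>

lemma at_upd_upd_count:
  assumes "1 \<le> j" "blk k j = i"
  shows "at_upd blk p i k (upd_count blk k j i) = p k j"
proof -
  have "(THE l. 1 \<le> l \<and> blk k l = i \<and> upd_count blk k l i = upd_count blk k j i) = j"
  proof (rule the_equality)
    fix l assume "1 \<le> l \<and> blk k l = i \<and> upd_count blk k l i = upd_count blk k j i"
    then show "l = j"
      using upd_count_less[of l j blk k i] upd_count_less[of j l blk k i] assms by (cases l j rule: linorder_cases) auto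
  qed (use assms in auto)
  then show ?thesis by (simp add: at_upd_def)
qed

lemma upd_count_in_range:
  assumes "j \<in> {1..T k}" "blk k j = i"
  shows "upd_count blk k j i \<in> {1..num_upd T blk k i}"
  using assms upd_count_less[of 0 j blk k i] upd_count_mono[of j "T k" blk k i]
  by (auto simp: num_upd_def)

text \<open>
  A common abstraction of both methods: \<open>\<phi> k j\<close> is the function that is minimised together with
  \<open>r i\<close>. The coefficient \<open>\<theta>\<close> stands for the paper's \<open>\<theta>\<close> (IBP) and \<open>\<lambda>\<close> (IBPG).
\<close>

locale inertial_block_scheme =
  fixes E :: "'s::finite \<Rightarrow> 'a::euclidean_space set"
    and f :: "'a^'s \<Rightarrow> real"
    and r :: "'s \<Rightarrow> 'a \<Rightarrow> ereal"
    and T :: "nat \<Rightarrow> nat"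
    and blk :: "nat \<Rightarrow> nat \<Rightarrow> 's"
    and xt :: "nat \<Rightarrow> 'a^'s"
    and x :: "nat \<Rightarrow> nat \<Rightarrow> 'a^'s"
    and \<phi> :: "nat \<Rightarrow> nat \<Rightarrow> 'a \<Rightarrow> real"
    and \<theta> :: "'s \<Rightarrow> nat \<Rightarrow> nat \<Rightarrow> real"
    and \<eta> :: "nat \<Rightarrow> nat \<Rightarrow> real"
    and \<delta> W :: real
  assumes S: "\<And>i. subspace (E i)"
    and f: "continuous_on (block_space E) f"
    and r_proper: "\<And>i. proper_on (E i) (r i)"
    and r_lsc: "\<And>i. lsc_on (E i) (r i)"
    and updates: "updates_all_blocks T blk"
    and scheme: "block_scheme E T blk xt x"
    and argmin: "\<And>k j. 1 \<le> k \<Longrightarrow> j \<in> {1..T k} \<Longrightarrow>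
      is_arg_min (\<lambda>u. r (blk k j) u + ereal (\<phi> k j u)) (\<lambda>u. u \<in> E (blk k j)) (x k j $ blk k j)"
    and decrease: "\<And>k j i. \<lbrakk>1 \<le> k; j \<in> {1..T k}; i = blk k j;
        x k j \<in> block_space E; x k (j - 1) \<in> block_space E;
        prev_val T blk xt x k (j - 1) \<in> block_space E\<rbrakk> \<Longrightarrow>
      f (x k j) - f (x k (j - 1)) \<le> \<phi> k j (x k j $ i) - \<phi> k j (x k (j - 1) $ i)
        + \<theta> i k (upd_count blk k j i) * (norm (x k (j - 1) $ i - prev_val T blk xt x k (j - 1) $ i))\<^sup>2
        - \<eta> k j * (norm (x k j $ i - x k (j - 1) $ i))\<^sup>2"
    and \<eta>_ge: "\<And>k j. 1 \<le> k \<Longrightarrow> j \<in> {1..T k} \<Longrightarrow>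
      \<delta> * extend_upd T blk \<theta> (blk k j) k (upd_count blk k j (blk k j) + 1) \<le> \<eta> k j"
    and \<theta>_ge: "\<And>i k m. 1 \<le> k \<Longrightarrow> m \<in> {1..num_upd T blk k i} \<Longrightarrow> W \<le> \<theta> i k m"
    and W: "0 < W" and \<delta>: "1 < \<delta>"
begin

abbreviation prev :: "nat \<Rightarrow> nat \<Rightarrow> 'a^'s" where
  "prev \<equiv> prev_val T blk xt x"

text \<open>Thanks to \<open>extend_upd\<close>, the value at the end of an outer loop is that at the start of the next one.\<close>

definition next_coeff :: "nat \<Rightarrow> nat \<Rightarrow> 's \<Rightarrow> real" where
  "next_coeff k j i = extend_upd T blk \<theta> i k (upd_count blk k j i + 1)"

text \<open>The Lyapunov function. The last step of each block carries the coefficient at which the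
  next update of that block will charge it. \<open>real_of_ereal\<close> is faithful from the end of
  outer loop 1 on, when all values of r are finite.\<close>

definition \<Phi> :: "nat \<Rightarrow> nat \<Rightarrow> real" where
  "\<Phi> k j = f (x k j) + (\<Sum>i\<in>UNIV. real_of_ereal (r i (x k j $ i)))
     + (\<Sum>i\<in>UNIV. next_coeff k j i * (norm (x k j $ i - prev k j $ i))\<^sup>2)"

section \<open>Membership and finiteness along the iterations\<close>

lemma block_updated: "1 \<le> k \<Longrightarrow> \<exists>j\<in>{1..T k}. blk k j = i"
  using updates unfolding updates_all_blocks_def by blast

lemma num_upd_pos: "1 \<le> k \<Longrightarrow> 1 \<le> num_upd T blk k i"
  using block_updated[of k i] upd_count_in_range[of _ T k blk i] by fastforce

text \<open>The index always belongs to a real update: past the last one in loop k it means the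
  first one in loop \<open>k + 1\<close>, and every loop updates every block.\<close>

lemma next_coeff_ge: "1 \<le> k \<Longrightarrow> W \<le> next_coeff k j i"
  using num_upd_pos[of "k + 1" i] \<theta>_ge by (auto simp: next_coeff_def extend_upd_def)

lemma x_0: "1 \<le> k \<Longrightarrow> x k 0 = xt (k - 1)"
  and xt_eq: "1 \<le> k \<Longrightarrow> xt k = x k (T k)"
  and x_unchanged: "1 \<le> k \<Longrightarrow> j \<in> {1..T k} \<Longrightarrow> i \<noteq> blk k j \<Longrightarrow> x k j $ i = x k (j - 1) $ i"
  using scheme unfolding block_scheme_def by auto

lemma x_updated_mem: "1 \<le> k \<Longrightarrow> j \<in> {1..T k} \<Longrightarrow> x k j $ blk k j \<in> E (blk k j)"
  using argmin[of k j] by (simp add: is_arg_min_def)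

lemma argmin_le:
  assumes "1 \<le> k" "j \<in> {1..T k}" "u \<in> E (blk k j)"
  shows "r (blk k j) (x k j $ blk k j) + ereal (\<phi> k j (x k j $ blk k j))
    \<le> r (blk k j) u + ereal (\<phi> k j u)"
  using argmin[OF assms(1,2)] assms(3) by (auto simp: is_arg_min_def not_less)

text \<open>A minimiser is compared with a point of finite r, which exists by properness.\<close>

lemma r_updated_finite:
  assumes "1 \<le> k" "j \<in> {1..T k}"
  shows "\<bar>r (blk k j) (x k j $ blk k j)\<bar> \<noteq> \<infinity>"
proof -
  obtain u where "u \<in> E (blk k j)" "r (blk k j) u \<noteq> \<infinity>"
    using r_proper unfolding proper_on_def by blast
  with argmin_le[OF assms, of u] have "r (blk k j) (x k j $ blk k j) \<noteq> \<infinity>" by auto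
  moreover have "r (blk k j) (x k j $ blk k j) \<noteq> -\<infinity>"
    using r_proper x_updated_mem[OF assms] unfolding proper_on_def by blast
  ultimately show ?thesis by auto
qed

lemma x_Suc_mem:
  assumes "1 \<le> k" "j \<in> {1..T k}" "x k (j - 1) \<in> block_space E"
  shows "x k j \<in> block_space E"
proof -
  have "x k j $ i \<in> E i" for i
    using x_unchanged[OF assms(1,2), of i] x_updated_mem[OF assms(1,2)] assms(3)
    by (cases "i = blk k j") (auto simp: block_space_def)
  then show ?thesis by (simp add: block_space_def)
qed

lemma x_mem_aux: "1 \<le> k \<Longrightarrow> xt (k - 1) \<in> block_space E \<Longrightarrow> j \<le> T k \<Longrightarrow> x k j \<in> block_space E"
proof (induction j)
  case 0
  then show ?case by (simp add: x_0)
next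
  case (Suc j)
  then show ?case using x_Suc_mem[of k "Suc j"] by simp
qed

lemma xt_mem: "xt k \<in> block_space E"
proof (induction k)
  case 0
  show ?case using scheme by (simp add: block_scheme_def)
next
  case (Suc k)
  then show ?case using x_mem_aux[of "Suc k" "T (Suc k)"] by (simp add: xt_eq)
qed

lemma x_mem: "1 \<le> k \<Longrightarrow> j \<le> T k \<Longrightarrow> x k j \<in> block_space E"
  using x_mem_aux xt_mem by blast

lemma prev_step:
  assumes "1 \<le> k" "j \<in> {1..T k}"
  shows "prev k j = block_upd (prev k (j - 1)) (blk k j) (x k (j - 1) $ blk k j)"
proof -
  obtain k' j' where "k = Suc k'" "j = Suc j'" using assms by (cases k; cases j) auto
  then show ?thesis by simp
qed

lemma prev_mem: "j \<le> T k \<Longrightarrow> prev k j \<in> block_space E"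
proof (induction k arbitrary: j)
  case 0
  show ?case using xt_mem by simp
next
  case (Suc k)
  from Suc.prems show ?case
  proof (induction j)
    case 0
    show ?case using Suc.IH by simp
  next
    case (Suc j)
    then show ?case
      using x_mem[of "Suc k" j] by (simp add: block_space_def block_upd_nth)
  qed
qed

text \<open>A block has a finite value from its first update on; before that it may still hold the
  starting value, where r can be infinite.\<close>

lemma r_finite_aux:
  assumes "1 \<le> k" "j \<le> T k" "\<exists>l\<in>{1..j}. blk k l = i"
  shows "\<bar>r i (x k j $ i)\<bar> \<noteq> \<infinity>"
  using assms(2,3)
proof (induction j)
  case (Suc j)
  show ?case
  proof (cases "blk k (Suc j) = i")
    case True
    then show ?thesis using r_updated_finite[of k "Suc j"] assms(1) Suc.prems by auto
  next
    case False
    then have "x k (Suc j) $ i = x k j $ i" "\<exists>l\<in>{1..j}. blk k l = i"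
      using x_unchanged[of k "Suc j" i] assms(1) Suc.prems by (auto simp: le_Suc_eq)
    with Suc show ?thesis by simp
  qed
qed simp

lemma r_xt_finite: "1 \<le> k \<Longrightarrow> \<bar>r i (xt k $ i)\<bar> \<noteq> \<infinity>"
  using r_finite_aux[of k "T k" i] block_updated[of k i] by (simp add: xt_eq)

text \<open>Outer loop 1 has replaced every starting value, hence the bound 2 on k.\<close>

lemma r_finite:
  assumes "2 \<le> k" "j \<le> T k"
  shows "\<bar>r i (x k j $ i)\<bar> \<noteq> \<infinity>"
  using assms(2)
proof (induction j)
  case 0
  then show ?case using r_xt_finite[of "k - 1"] assms(1) by (simp add: x_0)
next
  case (Suc j)
  then show ?case
    using x_unchanged[of k "Suc j" i] r_updated_finite[of k "Suc j"] assms(1)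
    by (cases "i = blk k (Suc j)") auto
qed

section \<open>Decrease of the Lyapunov function\<close>

lemma norm_step:
  assumes "1 \<le> k" "j \<in> {1..T k}"
  shows "norm (x k j $ blk k j - x k (j - 1) $ blk k j) = norm (x k j - x k (j - 1))"
proof -
  let ?d = "x k j - x k (j - 1)"
  have "(\<Sum>i\<in>UNIV. (norm (?d $ i))\<^sup>2) = (\<Sum>i\<in>{blk k j}. (norm (?d $ i))\<^sup>2)"
    using x_unchanged[OF assms] by (intro sum.mono_neutral_right) auto
  then show ?thesis by (simp add: norm_vec_def L2_set_def)
qed

text \<open>The term by which the objective may grow is exactly the weighted square that the updated
  block gives up. The new step brings in \<open>next_coeff\<close> times its square, but lowers the
  objective by at least \<delta> times as much; the excess is at least
  \<open>(\<delta> - 1) * W\<close>.\<close>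

lemma \<Phi>_step:
  assumes k: "2 \<le> k" and j: "j \<in> {1..T k}"
  shows "\<Phi> k j + (\<delta> - 1) * W * (norm (x k j - x k (j - 1)))\<^sup>2 \<le> \<Phi> k (j - 1)"
proof -
  have k1: "1 \<le> k" using k by simp
  define i where "i = blk k j"
  define a where "a = norm (x k (j - 1) $ i - prev k (j - 1) $ i)"
  define b where "b = norm (x k j $ i - x k (j - 1) $ i)"
  define \<rho> where "\<rho> j l = real_of_ereal (r l (x k j $ l))" for j l
  define w where "w j l = next_coeff k j l * (norm (x k j $ l - prev k j $ l))\<^sup>2" for j l
  \<comment> \<open>Only block i changes, so sums over all blocks differ in one term.\<close>
  have diff: "sum g UNIV - sum h UNIV = g i - h i" if "\<And>l. l \<noteq> i \<Longrightarrow> g l = h l"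
    for g h :: "'s \<Rightarrow> real"
  proof -
    have "(\<Sum>l\<in>UNIV. g l - h l) = (\<Sum>l\<in>{i}. g l - h l)"
      by (rule sum.mono_neutral_right) (use that in auto)
    then show ?thesis by (simp add: sum_subtractf)
  qed
  have mem: "x k j \<in> block_space E" "x k (j - 1) \<in> block_space E" "prev k (j - 1) \<in> block_space E"
    using j k x_mem[of k] prev_mem[of _ k] by auto
  have unch: "x k j $ l = x k (j - 1) $ l" if "l \<noteq> i" for l
    using x_unchanged[OF k1 j] that by (simp add: i_def)
  obtain j' where j': "j = Suc j'" using j by (cases j) auto
  have count: "upd_count blk k j l = upd_count blk k (j - 1) l + (if l = i then 1 else 0)" for l
    using j' by (auto simp: upd_count_Suc i_def)
  have Pi: "prev k j $ l = (if l = i then x k (j - 1) $ i else prev k (j - 1) $ l)" for l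
    using prev_step[OF k1 j] by (simp add: i_def block_upd_nth)
  have "sum (\<rho> j) UNIV - sum (\<rho> (j - 1)) UNIV = \<rho> j i - \<rho> (j - 1) i"
    by (rule diff) (simp add: \<rho>_def unch)
  moreover have "sum (w j) UNIV - sum (w (j - 1)) UNIV = w j i - w (j - 1) i"
    by (rule diff) (simp add: w_def unch next_coeff_def count Pi)
  moreover have "w j i = next_coeff k j i * b\<^sup>2" by (simp add: w_def b_def Pi)
  \<comment> \<open>The count before the update plus one is the number of this update, so the stored
    weight is the coefficient in \<open>decrease\<close>.\<close>
  moreover have "w (j - 1) i = \<theta> i k (upd_count blk k j i) * a\<^sup>2"
    using upd_count_in_range[of j T k blk i] j by (simp add: w_def a_def next_coeff_def extend_upd_def count i_def)
  moreover have "\<rho> j i + \<phi> k j (x k j $ i) \<le> \<rho> (j - 1) i + \<phi> k j (x k (j - 1) $ i)"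
  proof -
    have "j \<le> T k" "j - 1 \<le> T k" using j by auto
    then have "r i (x k j $ i) = ereal (\<rho> j i)" "r i (x k (j - 1) $ i) = ereal (\<rho> (j - 1) i)"
      using r_finite[OF k] by (simp_all add: \<rho>_def ereal_real)
    moreover have "x k (j - 1) $ i \<in> E i" using mem by (simp add: block_space_def)
    ultimately show ?thesis
      using argmin_le[OF k1 j, of "x k (j - 1) $ i"] by (simp add: i_def)
  qed
  moreover have "f (x k j) - f (x k (j - 1)) \<le> \<phi> k j (x k j $ i) - \<phi> k j (x k (j - 1) $ i)
      + \<theta> i k (upd_count blk k j i) * a\<^sup>2 - \<eta> k j * b\<^sup>2"
    unfolding a_def b_def by (rule decrease[OF k1 j i_def mem])
  moreover have "next_coeff k j i * b\<^sup>2 + (\<delta> - 1) * W * b\<^sup>2 \<le> \<eta> k j * b\<^sup>2"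
  proof -
    have "(\<delta> - 1) * W \<le> (\<delta> - 1) * next_coeff k j i" using \<delta> next_coeff_ge[OF k1] by (intro mult_left_mono) auto
    with \<eta>_ge[OF k1 j] have "next_coeff k j i + (\<delta> - 1) * W \<le> \<eta> k j"
      by (simp add: next_coeff_def i_def algebra_simps)
    from mult_right_mono[OF this, of "b\<^sup>2"] show ?thesis by (simp add: algebra_simps)
  qed
  moreover have "\<Phi> k j = f (x k j) + sum (\<rho> j) UNIV + sum (w j) UNIV" for j
    by (simp add: \<Phi>_def \<rho>_def w_def)
  moreover have "norm (x k j - x k (j - 1)) = b"
    using norm_step[OF k1 j] by (simp add: b_def i_def)
  ultimately show ?thesis by simp
qed

lemma \<Phi>_sum:
  assumes "2 \<le> k" "j \<le> T k"
  shows "\<Phi> k j + (\<delta> - 1) * W * (\<Sum>l=1..j. (norm (x k l - x k (l - 1)))\<^sup>2) \<le> \<Phi> k 0"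
  using assms(2)
proof (induction j)
  case (Suc j)
  then show ?case using \<Phi>_step[OF assms(1), of "Suc j"] by (simp add: distrib_left)
qed simp

lemma \<Phi>_link: "1 \<le> k \<Longrightarrow> \<Phi> (Suc k) 0 = \<Phi> k (T k)"
  using num_upd_pos[of "Suc k"]
  by (simp add: \<Phi>_def x_0 xt_eq next_coeff_def extend_upd_def upd_count_def[of _ _ 0])
    (simp add: num_upd_def)

text \<open>Shifted by one, since \<open>r\<close> may be infinite at the starting point.\<close>

definition \<Psi> :: "nat \<Rightarrow> real" where
  "\<Psi> n = \<Phi> (Suc n) (T (Suc n))"

text \<open>The total decrease over a loop bounds the sum of all its squared steps, in particular
  each single one.\<close>

lemma \<Psi>_step:
  assumes "j \<in> {1..T (Suc (Suc n))}"
  shows "(\<delta> - 1) * W * (norm (x (Suc (Suc n)) j - x (Suc (Suc n)) (j - 1)))\<^sup>2 \<le> \<Psi> n - \<Psi> (Suc n)"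
proof -
  let ?g = "\<lambda>l. (norm (x (Suc (Suc n)) l - x (Suc (Suc n)) (l - 1)))\<^sup>2"
  have "?g j \<le> (\<Sum>l=1..T (Suc (Suc n)). ?g l)" using assms by (intro member_le_sum) auto
  then have "(\<delta> - 1) * W * ?g j \<le> (\<delta> - 1) * W * (\<Sum>l=1..T (Suc (Suc n)). ?g l)"
    using \<delta> W by (intro mult_left_mono) auto
  with \<Phi>_sum[of "Suc (Suc n)" "T (Suc (Suc n))"] show ?thesis
    by (simp add: \<Psi>_def \<Phi>_link)
qed

lemma decseq_\<Psi>: "decseq \<Psi>"
proof (rule decseq_SucI)
  fix n
  \<comment> \<open>\<open>blk 0 0\<close> merely names some block; the point is that the loop is
    not empty.\<close>
  obtain j where "j \<in> {1..T (Suc (Suc n))}" using block_updated[of "Suc (Suc n)" "blk 0 0"] by auto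
  moreover have "0 \<le> (\<delta> - 1) * W * (norm v)\<^sup>2" for v :: "'a^'s" using \<delta> W by simp
  ultimately show "\<Psi> (Suc n) \<le> \<Psi> n" using \<Psi>_step by (smt (verit))
qed

end

section \<open>Vanishing steps in the presence of a limit point\<close>

locale inertial_block_scheme_limit_point = inertial_block_scheme E f r T blk xt x \<phi> \<theta> \<eta> \<delta> W
  for E :: "'s::finite \<Rightarrow> 'a::euclidean_space set" and f r T blk xt x \<phi> \<theta> \<eta> \<delta> W +
  fixes z :: "'a^'s"
  assumes limit_point: "seq_limit_point xt z"
begin

lemma z_mem: "z \<in> block_space E"
proof -
  obtain \<rho> where "(xt \<circ> \<rho>) \<longlonglongrightarrow> z"
    using limit_point unfolding seq_limit_point_def by blast
  moreover have "closed (block_space E)"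
    using S by (intro closed_subspace subspace_block_space)
  ultimately show ?thesis
    using xt_mem closed_sequentially[of "block_space E" "xt \<circ> \<rho>" z] by simp
qed

lemma z_nth_mem: "z $ i \<in> E i"
  using z_mem by (simp add: block_space_def)

lemma \<Psi>_bounded_below: "\<exists>B. \<forall>n. B \<le> \<Psi> n"
proof -
  obtain \<rho> where \<rho>: "strict_mono \<rho>" "(xt \<circ> \<rho>) \<longlonglongrightarrow> z"
    using limit_point unfolding seq_limit_point_def by blast
  \<comment> \<open>Properness excludes -\<infinity>; whether r is finite at z is settled only by
    the limiting inequality, so a real lower value is chosen here.\<close>
  have "\<exists>a::real. ereal a < r i (z $ i)" for i
    using r_proper[of i] z_nth_mem[of i] ereal_dense2[of "-\<infinity>" "r i (z $ i)"]
    by (auto simp: proper_on_def)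
  then obtain a :: "'s \<Rightarrow> real" where a: "ereal (a i) < r i (z $ i)" for i by metis
  have "\<forall>\<^sub>F n in sequentially. ereal (a i) < r i (xt (\<rho> n) $ i)" for i
    using \<rho>(2) xt_mem
    by (intro lsc_on_eventually_less[OF r_lsc z_nth_mem a, of "\<lambda>n. xt (\<rho> n) $ i"] tendsto_vec_nth)
      (auto simp: o_def block_space_def)
  then have ev_r: "\<forall>\<^sub>F n in sequentially. \<forall>i. ereal (a i) < r i (xt (\<rho> n) $ i)"
    by (rule eventually_all_finite)
  have "(\<lambda>n. f (xt (\<rho> n))) \<longlonglongrightarrow> f z"
    using continuous_on_tendsto_compose[OF f \<rho>(2) z_mem] xt_mem by (simp add: o_def)
  then have ev_f: "\<forall>\<^sub>F n in sequentially. f z - 1 < f (xt (\<rho> n))"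
    by (rule order_tendstoD) simp
  define B where "B = f z - 1 + sum a UNIV"
  \<comment> \<open>Subtracting 1 undoes the shift in \<open>\<Psi>\<close>: the index
    \<open>\<rho> n - 1\<close> refers to the end of loop \<open>\<rho> n\<close>.\<close>
  have "\<forall>\<^sub>F n in sequentially. B \<le> \<Psi> (\<rho> n - 1)"
    using ev_r ev_f eventually_gt_at_top[of 0]
  proof eventually_elim
    case (elim n)
    then have k: "1 \<le> \<rho> n" using seq_suble[OF \<rho>(1), of n] by simp
    have "a i \<le> real_of_ereal (r i (xt (\<rho> n) $ i))" for i
      using elim(1) r_xt_finite[OF k, of i]
      by (metis ereal_less_eq(3) ereal_real less_imp_le)
    then have "sum a UNIV \<le> (\<Sum>i\<in>UNIV. real_of_ereal (r i (xt (\<rho> n) $ i)))"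
      by (rule sum_mono)
    moreover have "0 \<le> (\<Sum>i\<in>UNIV. next_coeff (\<rho> n) (T (\<rho> n)) i * (norm (x (\<rho> n) (T (\<rho> n)) $ i - prev (\<rho> n) (T (\<rho> n)) $ i))\<^sup>2)"
      using next_coeff_ge[OF k] W by (intro sum_nonneg mult_nonneg_nonneg) (auto intro: order_trans less_imp_le)
    ultimately have "B \<le> \<Phi> (\<rho> n) (T (\<rho> n))"
      using elim(2) k by (simp add: B_def \<Phi>_def xt_eq)
    with k show ?case by (simp add: \<Psi>_def)
  qed
  then obtain N where N: "B \<le> \<Psi> (\<rho> n - 1)" if "n \<ge> N" for n
    by (auto simp: eventually_at_top_linorder)
  have "B \<le> \<Psi> n" for n
  proof -
    \<comment> \<open>A member of the subsequence beyond both n and N; the successor compensates for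
      the subtraction of 1.\<close>
    have "n \<le> \<rho> (Suc (max n N)) - 1" using seq_suble[OF \<rho>(1), of "Suc (max n N)"] by simp
    then have "\<Psi> (\<rho> (Suc (max n N)) - 1) \<le> \<Psi> n" using decseq_\<Psi> by (simp add: decseq_def)
    with N[OF le_SucI[OF max.cobounded2], of n] show ?thesis by simp
  qed
  then show ?thesis by blast
qed

text \<open>For k at least 2, the numerator is the decrease of \<open>\<Phi>\<close> from the end of
  loop \<open>k - 1\<close> to the end of loop k.\<close>

definition step_bound :: "nat \<Rightarrow> real" where
  "step_bound k = sqrt ((\<Psi> (k - 2) - \<Psi> (k - 1)) / ((\<delta> - 1) * W))"

lemma step_bound_nonneg: "0 \<le> step_bound k"
  using decseq_\<Psi> \<delta> W by (auto simp: step_bound_def decseq_def intro!: divide_nonneg_nonneg)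

lemma step_le_step_bound:
  assumes "2 \<le> k" "j \<in> {1..T k}"
  shows "norm (x k j - x k (j - 1)) \<le> step_bound k"
proof -
  obtain n where "k = Suc (Suc n)" using assms(1) by (metis add_2_eq_Suc le_Suc_ex)
  moreover have "0 < (\<delta> - 1) * W" using \<delta> W by simp
  ultimately show ?thesis
    using \<Psi>_step[of j n] assms(2) unfolding step_bound_def
    by (intro real_le_rsqrt) (simp add: pos_le_divide_eq mult.commute)
qed

text \<open>A decreasing sequence that is bounded below converges, so its consecutive differences
  tend to 0.\<close>

lemma step_bound_tendsto_0: "step_bound \<longlonglongrightarrow> 0"
proof -
  obtain B where "\<And>n. B \<le> \<Psi> n" using \<Psi>_bounded_below by blast
  then obtain l where l: "\<Psi> \<longlonglongrightarrow> l" using decseq_convergent[OF decseq_\<Psi>] by metis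
  have "(\<lambda>n. sqrt ((\<Psi> n - \<Psi> (Suc n)) / ((\<delta> - 1) * W))) \<longlonglongrightarrow> sqrt ((l - l) / ((\<delta> - 1) * W))"
    using \<delta> W by (intro tendsto_real_sqrt tendsto_divide tendsto_diff l LIMSEQ_Suc[OF l] tendsto_const) auto
  then have "(\<lambda>n. step_bound (n + 2)) \<longlonglongrightarrow> 0" by (simp add: step_bound_def)
  then show ?thesis by (rule LIMSEQ_offset)
qed

section \<open>Convergence of all inner iterates near the subsequence\<close>

lemma x_diff_start:
  assumes "2 \<le> k" "j \<le> T k"
  shows "norm (x k j - x k 0) \<le> j * step_bound k"
  using assms(2)
proof (induction j)
  case (Suc j)
  have "norm (x k (Suc j) - x k 0) \<le> norm (x k (Suc j) - x k j) + norm (x k j - x k 0)"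
    using norm_triangle_ineq[of "x k (Suc j) - x k j" "x k j - x k 0"] by simp
  then show ?case using Suc step_le_step_bound[OF assms(1), of "Suc j"] by (simp add: algebra_simps)
qed simp

text \<open>Once block i has been updated in loop k, the difference is its last step within this
  loop. Until then both values are those at the start of the loop; this alternative makes the
  induction go through.\<close>

lemma prev_diff_aux:
  assumes "2 \<le> k" "j \<le> T k"
  shows "norm (x k j $ i - prev k j $ i) \<le> step_bound k \<or>
    (\<forall>l\<in>{1..j}. blk k l \<noteq> i) \<and> x k j $ i = x k 0 $ i \<and> prev k j $ i = prev k 0 $ i"
  using assms(2)
proof (induction j)
  case (Suc j)
  have prev: "prev k (Suc j) = block_upd (prev k j) (blk k (Suc j)) (x k j $ blk k (Suc j))"
    using prev_step[of k "Suc j"] assms(1) Suc.prems by simp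
  show ?case
  proof (cases "blk k (Suc j) = i")
    case True
    then have "norm (x k (Suc j) $ i - prev k (Suc j) $ i) = norm (x k (Suc j) - x k j)"
      using norm_step[of k "Suc j"] assms(1) Suc.prems by (simp add: prev block_upd_nth)
    then show ?thesis using step_le_step_bound[of k "Suc j"] assms(1) Suc.prems by simp
  next
    case False
    then have "x k (Suc j) $ i = x k j $ i" "prev k (Suc j) $ i = prev k j $ i"
      using x_unchanged[of k "Suc j" i] assms(1) Suc.prems by (auto simp: prev block_upd_nth)
    with False Suc show ?thesis by (auto simp: le_Suc_eq)
  qed
qed simp

text \<open>If block i is still untouched in loop k, its last step was made in loop
  \<open>k - 1\<close>. Step bounds are valid from loop 2 on, hence the bound 3 on k.\<close>

lemma prev_diff:
  assumes "3 \<le> k" "j \<le> T k"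
  shows "norm (x k j $ i - prev k j $ i) \<le> step_bound k + step_bound (k - 1)"
proof -
  obtain k' where k': "k = Suc k'" "2 \<le> k'" using assms(1) by (cases k) auto
  have "norm (x k' (T k') $ i - prev k' (T k') $ i) \<le> step_bound k'"
    using prev_diff_aux[OF k'(2), of "T k'" i] block_updated[of k' i] k' by auto
  then have "norm (x k 0 $ i - prev k 0 $ i) \<le> step_bound k'"
    using k' by (simp add: x_0 xt_eq)
  with prev_diff_aux[of k j i] assms step_bound_nonneg[of k] step_bound_nonneg[of k'] k' show ?thesis by auto
qed

text \<open>One update of block i is picked in each outer loop of the convergent subsequence. Loops
  have bounded length, so every inner iterate of such a loop is within a fixed multiple of
  \<open>step_bound\<close> of its end.\<close>

lemma update_times:
  obtains K J :: "nat \<Rightarrow> nat"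
  where "\<And>n. 1 \<le> K n" "\<And>n. J n \<in> {1..T (K n)}" "\<And>n. blk (K n) (J n) = i"
    "(\<lambda>n. x (K n) (J n)) \<longlonglongrightarrow> z" "(\<lambda>n. x (K n) (J n - 1)) \<longlonglongrightarrow> z"
    "(\<lambda>n. prev (K n) (J n - 1) $ i) \<longlonglongrightarrow> z $ i"
proof -
  obtain \<rho> where \<rho>: "strict_mono \<rho>" "(xt \<circ> \<rho>) \<longlonglongrightarrow> z"
    using limit_point unfolding seq_limit_point_def by blast
  obtain Tbar where Tbar: "\<And>k. 1 \<le> k \<Longrightarrow> T k \<le> Tbar"
    using updates unfolding updates_all_blocks_def by blast
  \<comment> \<open>The offset 3 puts every \<open>K n\<close> within the range of
    \<open>prev_diff\<close>.\<close>
  define K where "K n = \<rho> (n + 3)" for n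
  have K: "3 \<le> K n" for n using seq_suble[OF \<rho>(1), of "n + 3"] by (simp add: K_def)
  then have K1: "1 \<le> K n" and K2: "2 \<le> K n" for n
    by (simp_all add: order_trans[OF _ K])
  have "\<forall>n. \<exists>j. j \<in> {1..T (K n)} \<and> blk (K n) j = i"
    using block_updated[OF K1] by blast
  then obtain J where J: "\<And>n. J n \<in> {1..T (K n)}" "\<And>n. blk (K n) (J n) = i"
    by metis
  have subK: "strict_mono K" using \<rho>(1) by (simp add: K_def strict_mono_def)
  have eK: "(\<lambda>n. step_bound (K n)) \<longlonglongrightarrow> 0" "(\<lambda>n. step_bound (K n - 1)) \<longlonglongrightarrow> 0"
  proof -
    show "(\<lambda>n. step_bound (K n)) \<longlonglongrightarrow> 0"
      using LIMSEQ_subseq_LIMSEQ[OF step_bound_tendsto_0 subK] by (simp add: o_def)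
    have "strict_mono (\<lambda>n. K n - 1)"
      using subK K1 by (auto simp: strict_mono_def intro!: diff_less_mono)
    from LIMSEQ_subseq_LIMSEQ[OF step_bound_tendsto_0 this] show "(\<lambda>n. step_bound (K n - 1)) \<longlonglongrightarrow> 0"
      by (simp add: o_def)
  qed
  have xtK: "(\<lambda>n. xt (K n)) \<longlonglongrightarrow> z"
    using LIMSEQ_ignore_initial_segment[OF \<rho>(2), of 3] by (simp add: K_def o_def)
  \<comment> \<open>Kept general in the inner index, since it is applied both to \<open>J n\<close>
    and to \<open>J n - 1\<close>.\<close>
  have inner: "(\<lambda>n. x (K n) (I n)) \<longlonglongrightarrow> z" if I: "\<And>n. I n \<le> T (K n)" for I
  proof -
    have "norm (x (K n) (I n) - xt (K n)) \<le> 2 * Tbar * step_bound (K n)" for n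
    proof -
      have "norm (x (K n) (I n) - xt (K n))
          \<le> norm (x (K n) (I n) - x (K n) 0) + norm (x (K n) (T (K n)) - x (K n) 0)"
        unfolding xt_eq[OF K1]
        using norm_triangle_ineq4[of "x (K n) (I n) - x (K n) 0" "x (K n) (T (K n)) - x (K n) 0"] by simp
      also have "\<dots> \<le> real (I n) * step_bound (K n) + real (T (K n)) * step_bound (K n)"
        by (intro add_mono x_diff_start K2 I order_refl)
      also have "\<dots> \<le> real Tbar * step_bound (K n) + real Tbar * step_bound (K n)"
        using I[of n] Tbar[OF K1, of n] step_bound_nonneg[of "K n"] by (intro add_mono mult_right_mono) auto
      finally show ?thesis by simp
    qed
    then have "\<forall>n. norm (x (K n) (I n) - xt (K n)) \<le> 2 * Tbar * step_bound (K n)" ..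
    moreover have "(\<lambda>n. 2 * Tbar * step_bound (K n)) \<longlonglongrightarrow> 0"
      using eK(1) by (rule tendsto_mult_right_zero)
    ultimately have "(\<lambda>n. x (K n) (I n) - xt (K n)) \<longlonglongrightarrow> 0"
      by (rule Lim_null_comparison[OF always_eventually])
    from tendsto_add[OF this xtK] show ?thesis by simp
  qed
  show ?thesis
  proof (rule that[of K J])
    show "(\<lambda>n. x (K n) (J n)) \<longlonglongrightarrow> z" "(\<lambda>n. x (K n) (J n - 1)) \<longlonglongrightarrow> z"
      using J(1) by (auto intro!: inner le_diff_conv[THEN iffD2] trans_le_add1)
    then have "(\<lambda>n. x (K n) (J n - 1) $ i) \<longlonglongrightarrow> z $ i" by (intro tendsto_vec_nth)
    moreover have "(\<lambda>n. x (K n) (J n - 1) $ i - prev (K n) (J n - 1) $ i) \<longlonglongrightarrow> 0"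
    proof (rule Lim_null_comparison)
      have "J n - 1 \<le> T (K n)" for n using J(1)[of n] by auto
      then show "\<forall>\<^sub>F n in sequentially.
          norm (x (K n) (J n - 1) $ i - prev (K n) (J n - 1) $ i) \<le> step_bound (K n) + step_bound (K n - 1)"
        using K by (intro always_eventually allI prev_diff)
      show "(\<lambda>n. step_bound (K n) + step_bound (K n - 1)) \<longlonglongrightarrow> 0"
        using tendsto_add[OF eK] by simp
    qed
    ultimately show "(\<lambda>n. prev (K n) (J n - 1) $ i) \<longlonglongrightarrow> z $ i"
      using tendsto_diff by fastforce
  qed (use K1 J in auto)
qed

text \<open>Lower semicontinuity handles r at the new iterates. On the other side \<open>Q\<close>
  only has to dominate the increments of the model and to converge; the increments themselves, which
  contain the varying stepsizes, need not converge.\<close>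

lemma r_limit_le:
  assumes KJ: "\<And>n. 1 \<le> K n" "\<And>n. J n \<in> {1..T (K n)}" "\<And>n. blk (K n) (J n) = i"
    and x: "(\<lambda>n. x (K n) (J n)) \<longlonglongrightarrow> z"
    and u: "u \<in> E i"
    and Q: "\<And>n. \<phi> (K n) (J n) u - \<phi> (K n) (J n) (x (K n) (J n) $ i) \<le> Q n" "Q \<longlonglongrightarrow> q"
  shows "r i (z $ i) \<le> r i u + ereal q"
\<comment> \<open>Testing with all a below \<open>r i (z $ i)\<close> also covers the case that this
  value is infinite.\<close>
proof (rule dense_le)
  fix a assume a: "a < r i (z $ i)"
  have "\<forall>\<^sub>F n in sequentially. a < r i (x (K n) (J n) $ i)"
    using x_updated_mem[OF KJ(1,2)] x unfolding KJ(3)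
    by (intro lsc_on_eventually_less[OF r_lsc z_nth_mem a] tendsto_vec_nth) auto
  then have "\<forall>\<^sub>F n in sequentially. a \<le> r i u + ereal (Q n)"
  proof eventually_elim
    case (elim n)
    have "r i (x (K n) (J n) $ i) + ereal (\<phi> (K n) (J n) (x (K n) (J n) $ i))
        \<le> r i u + ereal (\<phi> (K n) (J n) u)"
      using argmin_le[OF KJ(1,2), of u n] u unfolding KJ(3) by simp
    then have "r i (x (K n) (J n) $ i)
        \<le> r i u + ereal (\<phi> (K n) (J n) u - \<phi> (K n) (J n) (x (K n) (J n) $ i))"
      by (cases "r i u"; cases "r i (x (K n) (J n) $ i)") auto
    also have "\<dots> \<le> r i u + ereal (Q n)" using Q(1) by (intro add_left_mono) simp
    finally show ?case using elim by simp
  qed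
  moreover have "(\<lambda>n. r i u + ereal (Q n)) \<longlonglongrightarrow> r i u + ereal q"
    using Q(2) by (intro tendsto_add_ereal_general tendsto_const) auto
  ultimately show "a \<le> r i u + ereal q" by (intro tendsto_lowerbound) auto
qed

text \<open>Comparison with one point of finite r: the limiting inequality itself puts z into the
  domain.\<close>

lemma r_z_finite:
  assumes "\<And>u. u \<in> E i \<Longrightarrow> r i (z $ i) \<le> r i u + ereal (q u)"
  shows "\<bar>r i (z $ i)\<bar> \<noteq> \<infinity>"
proof -
  obtain u where "u \<in> E i" "r i u \<noteq> \<infinity>" using r_proper unfolding proper_on_def by blast
  with assms[of u] have "r i (z $ i) \<noteq> \<infinity>" by auto
  moreover have "r i (z $ i) \<noteq> -\<infinity>"
    using r_proper z_nth_mem unfolding proper_on_def by blast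
  ultimately show ?thesis by auto
qed

end

section \<open>IBP and IBPG\<close>

locale inertial_block_problem =
  fixes E :: "'s::finite \<Rightarrow> 'a::euclidean_space set"
    and f :: "'a^'s \<Rightarrow> real"
    and r :: "'s \<Rightarrow> 'a \<Rightarrow> ereal"
    and H :: "'s \<Rightarrow> 'a \<Rightarrow> real"
    and \<sigma> LH :: "'s \<Rightarrow> real"
    and \<nu> \<delta> :: real
    and T :: "nat \<Rightarrow> nat"
    and blk :: "nat \<Rightarrow> nat \<Rightarrow> 's"
    and \<alpha> \<beta> :: "nat \<Rightarrow> nat \<Rightarrow> real"
    and xt :: "nat \<Rightarrow> 'a^'s"
    and x :: "nat \<Rightarrow> nat \<Rightarrow> 'a^'s"
    and z :: "'a^'s"
  assumes S: "\<And>i. subspace (E i)"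
    and f: "continuous_on (block_space E) f"
    and r_proper: "\<And>i. proper_on (E i) (r i)"
    and r_lsc: "\<And>i. lsc_on (E i) (r i)"
    and kernel: "kernel_assms E H \<sigma> LH"
    and updates: "updates_all_blocks T blk"
    and \<nu>: "0 < \<nu>" "\<nu> < 1" and \<delta>: "1 < \<delta>"
    and limit_point: "seq_limit_point xt z"
begin

section \<open>Estimates common to both methods\<close>

abbreviation (input) y :: "nat \<Rightarrow> nat \<Rightarrow> 'a^'s" where
  "y \<equiv> prev_val T blk xt x"

abbreviation D :: "'s \<Rightarrow> 'a \<Rightarrow> 'a \<Rightarrow> real" where
  "D i \<equiv> bregman (E i) (H i)"

lemma \<sigma>: "0 < \<sigma> i"
  and H_convex: "strongly_convex_on (E i) (\<sigma> i) (H i)"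
  and H_C1: "C1_on (E i) (H i)"
  and H_diff: "H i differentiable_on E i"
  and H_lip: "(LH i)-lipschitz_on (E i) (gradient_on (E i) (H i))"
  using kernel by (auto simp: kernel_assms_def C1_on_def)

lemma D_nonneg: "u \<in> E i \<Longrightarrow> v \<in> E i \<Longrightarrow> 0 \<le> D i u v"
  using bregman_ge[OF S _ _ H_diff H_convex] \<sigma>[of i]
  by (meson half_gt_zero less_imp_le mult_nonneg_nonneg order_trans zero_le_power2)

lemma block_upd_x:
  assumes "block_scheme E T blk xt x" "1 \<le> k" "j \<in> {1..T k}"
  shows "block_upd (x k (j - 1)) (blk k j) (x k j $ blk k j) = x k j"
  using assms by (auto simp: block_scheme_def vec_eq_iff block_upd_nth)

lemma extrapolate_eq:
  "extrapolate T blk xt x c k j =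
     x k (j - 1) $ blk k j + c k j *\<^sub>R (x k (j - 1) $ blk k j - y k (j - 1) $ blk k j)"
  by (simp add: extrapolate_def Let_def)

lemma extrapolate_mem:
  assumes "x k (j - 1) \<in> block_space E" "y k (j - 1) \<in> block_space E"
  shows "extrapolate T blk xt x c k j \<in> E (blk k j)"
  using assms S unfolding extrapolate_eq block_space_def
  by (auto intro!: subspace_add subspace_scale subspace_diff)

lemma bregman_decrease:
  assumes "i = blk k j" "x k j \<in> block_space E" "x k (j - 1) \<in> block_space E"
    "y k (j - 1) \<in> block_space E" "0 \<le> \<alpha> k j"
  shows "\<sigma> i / 2 * (norm (x k j $ i - x k (j - 1) $ i))\<^sup>2
      - LH i * \<alpha> k j * norm (x k (j - 1) $ i - y k (j - 1) $ i) * norm (x k j $ i - x k (j - 1) $ i)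
    \<le> D i (x k j $ i) (extrapolate T blk xt x \<alpha> k j) - D i (x k (j - 1) $ i) (extrapolate T blk xt x \<alpha> k j)"
  unfolding extrapolate_eq assms(1)
  using assms by (intro bregman_inertial_ge S H_diff H_convex H_lip) (auto simp: block_space_def)

lemma tendsto_extrapolate:
  assumes "(\<lambda>n. x (K n) (J n - 1)) \<longlonglongrightarrow> z" "(\<lambda>n. y (K n) (J n - 1) $ i) \<longlonglongrightarrow> z $ i"
    "\<And>n. blk (K n) (J n) = i" "\<And>n. \<bar>c (K n) (J n)\<bar> \<le> M"
  shows "(\<lambda>n. extrapolate T blk xt x c (K n) (J n)) \<longlonglongrightarrow> z $ i"
  unfolding extrapolate_eq assms(3)
  by (rule tendsto_extrapolated[OF tendsto_vec_nth[OF assms(1)] assms(2,4)])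

lemma tendsto_D:
  assumes "V \<longlonglongrightarrow> v" "v \<in> E i" "\<And>n. V n \<in> E i"
  shows "(\<lambda>n. D i u (V n)) \<longlonglongrightarrow> D i u v"
  using continuous_on_tendsto_compose[OF continuous_on_bregman[OF H_C1] assms(1,2)] assms(3) by simp

section \<open>IBP: descent and limiting inequality\<close>

definition IBP_model :: "nat \<Rightarrow> nat \<Rightarrow> 'a \<Rightarrow> real" where
  "IBP_model k j u = block_fun f blk x k j u
     + 1 / \<beta> k j * D (blk k j) u (extrapolate T blk xt x \<alpha> k j)"

text \<open>The model contains f exactly, so f and the model differ only by the Bregman term. Its
  gain is estimated by \<open>bregman_decrease\<close>, and division by \<beta> produces
  \<open>theta\<close>.\<close>

lemma IBP_scheme:
  assumes iter: "IBP_iterates E f r H T blk \<alpha> \<beta> xt x"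
    and params: "IBP_params T blk \<sigma> LH \<nu> \<delta> \<alpha> \<beta>"
    and W: "0 < W" "\<And>i k m. 1 \<le> k \<Longrightarrow> m \<in> {1..num_upd T blk k i} \<Longrightarrow> W \<le> theta blk \<sigma> LH \<nu> \<alpha> \<beta> i k m"
  shows "inertial_block_scheme E f r T blk xt x IBP_model (theta blk \<sigma> LH \<nu> \<alpha> \<beta>)
    (\<lambda>k j. (1 - \<nu>) * \<sigma> (blk k j) / (2 * \<beta> k j)) \<delta> W"
proof
  show scheme: "block_scheme E T blk xt x" using iter by (simp add: IBP_iterates_def)
  fix k j :: nat assume k: "1 \<le> k" and j: "j \<in> {1..T k}"
  have m: "upd_count blk k j (blk k j) \<in> {1..num_upd T blk k (blk k j)}"
    using j by (intro upd_count_in_range) simp_all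
  have pos: "0 \<le> \<alpha> k j" "0 < \<beta> k j" using params k j by (auto simp: IBP_params_def)
  show "is_arg_min (\<lambda>u. r (blk k j) u + ereal (IBP_model k j u)) (\<lambda>u. u \<in> E (blk k j)) (x k j $ blk k j)"
    using iter k j by (auto simp: IBP_iterates_def Let_def IBP_model_def ac_simps simp flip: plus_ereal.simps(1))
  show "\<delta> * extend_upd T blk (theta blk \<sigma> LH \<nu> \<alpha> \<beta>) (blk k j) k (upd_count blk k j (blk k j) + 1)
      \<le> (1 - \<nu>) * \<sigma> (blk k j) / (2 * \<beta> k j)"
    using params k m j unfolding IBP_params_def by (metis at_upd_upd_count atLeastAtMost_iff)
  fix i assume i: "i = blk k j" and mem: "x k j \<in> block_space E" "x k (j - 1) \<in> block_space E"
    "y k (j - 1) \<in> block_space E"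
  define a where "a = norm (x k (j - 1) $ i - y k (j - 1) $ i)"
  define b where "b = norm (x k j $ i - x k (j - 1) $ i)"
  have "\<sigma> i / 2 * b\<^sup>2 - (LH i * \<alpha> k j * a) * b
      \<le> D i (x k j $ i) (extrapolate T blk xt x \<alpha> k j) - D i (x k (j - 1) $ i) (extrapolate T blk xt x \<alpha> k j)"
    using bregman_decrease[OF i mem pos(1)] by (simp add: a_def b_def)
  \<comment> \<open>With \<epsilon> chosen as \<open>\<nu> * \<sigma> i\<close>, the share
    \<open>1 - \<nu>\<close> of the strong convexity is left for the new step.\<close>
  moreover have "(LH i * \<alpha> k j * a) * b \<le> \<nu> * \<sigma> i / 2 * b\<^sup>2 + (LH i * \<alpha> k j * a)\<^sup>2 / (2 * (\<nu> * \<sigma> i))"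
    using \<nu> \<sigma> by (intro young_inequality) simp
  ultimately have "(1 - \<nu>) * \<sigma> i / 2 * b\<^sup>2 - (LH i * \<alpha> k j * a)\<^sup>2 / (2 * (\<nu> * \<sigma> i))
      \<le> D i (x k j $ i) (extrapolate T blk xt x \<alpha> k j) - D i (x k (j - 1) $ i) (extrapolate T blk xt x \<alpha> k j)"
    by (simp add: algebra_simps diff_divide_distrib)
  from divide_right_mono[OF this, of "\<beta> k j"] pos
  have "(1 - \<nu>) * \<sigma> i / (2 * \<beta> k j) * b\<^sup>2 - (LH i * \<alpha> k j)\<^sup>2 / (2 * \<nu> * \<sigma> i * \<beta> k j) * a\<^sup>2
      \<le> 1 / \<beta> k j * D i (x k j $ i) (extrapolate T blk xt x \<alpha> k j)
        - 1 / \<beta> k j * D i (x k (j - 1) $ i) (extrapolate T blk xt x \<alpha> k j)"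
    by (simp add: diff_divide_distrib power_mult_distrib mult.assoc)
  moreover have "theta blk \<sigma> LH \<nu> \<alpha> \<beta> i k (upd_count blk k j i)
      = (LH i * \<alpha> k j)\<^sup>2 / (2 * \<nu> * \<sigma> i * \<beta> k j)"
    using j i by (simp add: theta_def at_upd_upd_count)
  ultimately show "f (x k j) - f (x k (j - 1)) \<le> IBP_model k j (x k j $ i) - IBP_model k j (x k (j - 1) $ i)
      + theta blk \<sigma> LH \<nu> \<alpha> \<beta> i k (upd_count blk k j i) * (norm (x k (j - 1) $ i - y k (j - 1) $ i))\<^sup>2
      - (1 - \<nu>) * \<sigma> (blk k j) / (2 * \<beta> k j) * (norm (x k j $ i - x k (j - 1) $ i))\<^sup>2"
    using block_upd_x[OF scheme k j]
    by (simp add: IBP_model_def block_fun_def i[symmetric] a_def b_def)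
qed (use S f r_proper r_lsc updates \<delta> W in auto)

lemma IBP_majorants:
  assumes iter: "IBP_iterates E f r H T blk \<alpha> \<beta> xt x"
    and params: "IBP_params T blk \<sigma> LH \<nu> \<delta> \<alpha> \<beta>"
    and bounds: "IBP_bounds T blk \<sigma> LH \<nu> \<alpha> \<beta>"
  shows "z \<in> block_space E \<and> (\<forall>i. \<bar>r i (z $ i)\<bar> \<noteq> \<infinity>) \<and>
    (\<exists>C. \<forall>i. \<forall>u\<in>E i. r i (z $ i) \<le> r i u + ereal (f (block_upd z i u) - f z + C * D i u (z $ i)))"
proof -
  obtain W \<alpha>max \<beta>min where W: "0 < W" and \<beta>min: "0 < \<beta>min"
    and b: "\<And>i k m. 1 \<le> k \<Longrightarrow> m \<in> {1..num_upd T blk k i} \<Longrightarrow>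
      W \<le> theta blk \<sigma> LH \<nu> \<alpha> \<beta> i k m \<and> at_upd blk \<alpha> i k m \<le> \<alpha>max \<and> \<beta>min \<le> at_upd blk \<beta> i k m"
    using bounds unfolding IBP_bounds_def by metis
  \<comment> \<open>Each inner iteration is the update of its block with number
    \<open>upd_count\<close>, so the bounds hold for every iteration.\<close>
  have bnd: "\<bar>\<alpha> k j\<bar> \<le> \<alpha>max" "\<beta>min \<le> \<beta> k j" if "1 \<le> k" "j \<in> {1..T k}" for k j
    using b[OF that(1) upd_count_in_range[of j T k blk, OF that(2) refl]] that params
    by (auto simp: at_upd_upd_count IBP_params_def)
  interpret inertial_block_scheme_limit_point E f r T blk xt x IBP_model "theta blk \<sigma> LH \<nu> \<alpha> \<beta>"
    "\<lambda>k j. (1 - \<nu>) * \<sigma> (blk k j) / (2 * \<beta> k j)" \<delta> W z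
    using IBP_scheme[OF iter params W] b limit_point
    by (simp add: inertial_block_scheme_limit_point_def inertial_block_scheme_limit_point_axioms_def)
  have key: "r i (z $ i) \<le> r i u + ereal (f (block_upd z i u) - f z + 1 / \<beta>min * D i u (z $ i))"
    if u: "u \<in> E i" for i u
  proof -
    obtain K J where K: "\<And>n. 1 \<le> K n" and J: "\<And>n. J n \<in> {1..T (K n)}"
      and blk: "\<And>n. blk (K n) (J n) = i"
      and lim: "(\<lambda>n. x (K n) (J n)) \<longlonglongrightarrow> z" "(\<lambda>n. x (K n) (J n - 1)) \<longlonglongrightarrow> z"
        "(\<lambda>n. y (K n) (J n - 1) $ i) \<longlonglongrightarrow> z $ i"
      by (rule update_times[of i]) (rule that)
    define v where "v n = extrapolate T blk xt x \<alpha> (K n) (J n)" for n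
    have J': "J n \<le> T (K n)" "J n - 1 \<le> T (K n)" for n using J[of n] by auto
    have mem: "x (K n) (J n) \<in> block_space E" "x (K n) (J n - 1) \<in> block_space E"
      "y (K n) (J n - 1) \<in> block_space E" for n
      using x_mem[OF K J'(1)] x_mem[OF K J'(2)] prev_mem[OF J'(2)] by auto
    have v: "v n \<in> E i" for n
      using extrapolate_mem[OF mem(2,3)] blk by (metis v_def)
    show ?thesis
    proof (rule r_limit_le[OF K J blk lim(1) u])
      fix n
      \<comment> \<open>The stepsizes may oscillate: at u their reciprocals are replaced by the
        bound \<open>1 / \<beta>min\<close>, and the nonnegative term at the new iterate is
        dropped.\<close>
      have "1 / \<beta> (K n) (J n) * D i u (v n) \<le> 1 / \<beta>min * D i u (v n)"
        using bnd(2)[OF K J, of n] \<beta>min by (intro mult_right_mono D_nonneg u v frac_le) auto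
      moreover have "0 \<le> 1 / \<beta> (K n) (J n) * D i (x (K n) (J n) $ i) (v n)"
        using bnd(2)[OF K J, of n] \<beta>min mem(1)[of n] by (intro mult_nonneg_nonneg D_nonneg v) (auto simp: block_space_def)
      ultimately show "IBP_model (K n) (J n) u - IBP_model (K n) (J n) (x (K n) (J n) $ i)
          \<le> f (block_upd (x (K n) (J n - 1)) i u) - f (x (K n) (J n)) + 1 / \<beta>min * D i u (v n)"
        using block_upd_x[OF scheme K J, of n] by (simp add: IBP_model_def block_fun_def blk v_def)
    next
      have "v \<longlonglongrightarrow> z $ i"
        unfolding v_def[abs_def] using bnd(1)[OF K J] by (intro tendsto_extrapolate lim blk)
      moreover have "(\<lambda>n. f (x (K n) (J n))) \<longlonglongrightarrow> f z"
        using continuous_on_tendsto_compose[OF f lim(1) z_mem] mem by simp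
      moreover have "(\<lambda>n. f (block_upd (x (K n) (J n - 1)) i u)) \<longlonglongrightarrow> f (block_upd z i u)"
        by (rule continuous_on_tendsto_compose[OF f tendsto_block_upd[OF lim(2) tendsto_const]])
          (auto intro!: always_eventually block_upd_mem z_mem mem u simp del: One_nat_def)
      ultimately show "(\<lambda>n. f (block_upd (x (K n) (J n - 1)) i u) - f (x (K n) (J n)) + 1 / \<beta>min * D i u (v n))
          \<longlonglongrightarrow> f (block_upd z i u) - f z + 1 / \<beta>min * D i u (z $ i)"
        by (intro tendsto_intros tendsto_D v z_nth_mem)
    qed
  qed
  then have "\<bar>r i (z $ i)\<bar> \<noteq> \<infinity>" for i by (rule r_z_finite)
  with z_mem key show ?thesis by (intro conjI allI exI[of _ "1 / \<beta>min"] ballI)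
qed

section \<open>IBPG: descent and limiting inequality\<close>

definition IBPG_grad :: "(nat \<Rightarrow> nat \<Rightarrow> real) \<Rightarrow> nat \<Rightarrow> nat \<Rightarrow> 'a" where
  "IBPG_grad \<gamma> k j = gradient_on (E (blk k j)) (block_fun f blk x k j) (extrapolate T blk xt x \<gamma> k j)"

definition IBPG_model :: "(nat \<Rightarrow> nat \<Rightarrow> real) \<Rightarrow> nat \<Rightarrow> nat \<Rightarrow> 'a \<Rightarrow> real" where
  "IBPG_model \<gamma> k j u = IBPG_grad \<gamma> k j \<bullet> u
     + 1 / \<beta> k j * D (blk k j) u (extrapolate T blk xt x \<alpha> k j)"

lemma block_fun_eq: "block_fun f blk x k j = (\<lambda>u. f (block_upd (x k (j - 1)) (blk k j) u))"
  by (simp add: block_fun_def fun_eq_iff)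

text \<open>The kernel supplies curvature \<open>\<kappa> * L k j\<close>, of which the descent
  lemma consumes \<open>L k j\<close>. The rest, positive as \<kappa> exceeds 1, is divided by \<nu>
  between the cross terms and the decrease.\<close>

lemma IBPG_scheme:
  assumes fC1: "C1_on (block_space E) f"
    and iter: "IBPG_iterates E f r H T blk \<alpha> \<beta> \<gamma> xt x"
    and \<kappa>: "1 < \<kappa>"
    and params: "IBPG_params E f T blk x \<sigma> LH \<nu> \<delta> \<kappa> \<alpha> \<beta> \<gamma> L"
    and W: "0 < W" "\<And>i k m. 1 \<le> k \<Longrightarrow> m \<in> {1..num_upd T blk k i} \<Longrightarrow>
      W \<le> lambda_coeff blk \<sigma> LH \<nu> \<kappa> \<alpha> \<gamma> L i k m"
  shows "inertial_block_scheme E f r T blk xt x (IBPG_model \<gamma>) (lambda_coeff blk \<sigma> LH \<nu> \<kappa> \<alpha> \<gamma> L)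
    (\<lambda>k j. (1 - \<nu>) * (\<kappa> - 1) * L k j / 2) \<delta> W"
proof
  show scheme: "block_scheme E T blk xt x" using iter by (simp add: IBPG_iterates_def)
  fix k j :: nat assume k: "1 \<le> k" and j: "j \<in> {1..T k}"
  have m: "upd_count blk k j (blk k j) \<in> {1..num_upd T blk k (blk k j)}"
    using j by (intro upd_count_in_range) simp_all
  have pos: "0 \<le> \<alpha> k j" "0 < \<beta> k j" "0 \<le> \<gamma> k j" "0 < L k j"
    and f_lip: "(L k j)-lipschitz_on (E (blk k j)) (gradient_on (E (blk k j)) (block_fun f blk x k j))"
    using params k j by (auto simp: IBPG_params_def)
  show "is_arg_min (\<lambda>u. r (blk k j) u + ereal (IBPG_model \<gamma> k j u)) (\<lambda>u. u \<in> E (blk k j)) (x k j $ blk k j)"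
    using iter k j
    by (auto simp: IBPG_iterates_def Let_def IBPG_model_def IBPG_grad_def ac_simps simp flip: plus_ereal.simps(1))
  show "\<delta> * extend_upd T blk (lambda_coeff blk \<sigma> LH \<nu> \<kappa> \<alpha> \<gamma> L) (blk k j) k (upd_count blk k j (blk k j) + 1)
      \<le> (1 - \<nu>) * (\<kappa> - 1) * L k j / 2"
    using params k m j unfolding IBPG_params_def by (metis at_upd_upd_count atLeastAtMost_iff)
  fix i assume i: "i = blk k j" and mem: "x k j \<in> block_space E" "x k (j - 1) \<in> block_space E"
    "y k (j - 1) \<in> block_space E"
  have \<beta>: "\<beta> k j = \<sigma> i / (\<kappa> * L k j)"
    using params k m j i unfolding IBPG_params_def by (metis at_upd_upd_count atLeastAtMost_iff)
  define a where "a = norm (x k (j - 1) $ i - y k (j - 1) $ i)"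
  define b where "b = norm (x k j $ i - x k (j - 1) $ i)"
  define g where "g = gradient_on (E i) (block_fun f blk x k j)"
  define w where "w = extrapolate T blk xt x \<gamma> k j"
  have w: "w \<in> E i" "dist (x k (j - 1) $ i) w = \<gamma> k j * a"
    using extrapolate_mem[OF mem(2,3)] pos by (simp_all add: w_def i extrapolate_eq a_def dist_norm)
  have xi: "x k j $ i \<in> E i" "x k (j - 1) $ i \<in> E i" using mem by (simp_all add: block_space_def)
  have fdiff: "block_fun f blk x k j differentiable_on E i"
    unfolding block_fun_eq i[symmetric] differentiable_on_def differentiable_def
    using has_derivative_block_fun[OF S _ mem(2)] fC1 unfolding C1_on_def by blast
  have "f (x k j) - f (x k (j - 1)) \<le> g (x k (j - 1) $ i) \<bullet> (x k j $ i - x k (j - 1) $ i) + L k j / 2 * b\<^sup>2"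
    using descent_lemma[OF S xi fdiff f_lip[folded i]] block_upd_x[OF scheme k j]
    by (simp add: g_def b_def block_fun_def i[symmetric])
  \<comment> \<open>The price of evaluating the gradient at the extrapolated point w instead of the
    current one.\<close>
  moreover have "(g (x k (j - 1) $ i) - g w) \<bullet> (x k j $ i - x k (j - 1) $ i) \<le> L k j * (\<gamma> k j * a) * b"
  proof -
    have "(g (x k (j - 1) $ i) - g w) \<bullet> (x k j $ i - x k (j - 1) $ i) \<le> norm (g (x k (j - 1) $ i) - g w) * b"
      unfolding b_def by (rule norm_cauchy_schwarz)
    also have "\<dots> \<le> L k j * (\<gamma> k j * a) * b"
      using lipschitz_onD[OF f_lip[folded i] xi(2) w(1)] w(2)
      by (intro mult_right_mono) (auto simp: g_def dist_norm b_def)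
    finally show ?thesis .
  qed
  \<comment> \<open>The parameter rule for \<beta> makes \<open>1 / \<beta> k j\<close> equal to
    \<open>\<kappa> * L k j / \<sigma> i\<close>.\<close>
  moreover have "\<kappa> * L k j / 2 * b\<^sup>2 - \<kappa> * L k j / \<sigma> i * (LH i * \<alpha> k j * a) * b
      \<le> 1 / \<beta> k j * D i (x k j $ i) (extrapolate T blk xt x \<alpha> k j)
        - 1 / \<beta> k j * D i (x k (j - 1) $ i) (extrapolate T blk xt x \<alpha> k j)"
  proof -
    have "\<sigma> i / 2 * b\<^sup>2 - LH i * \<alpha> k j * a * b
        \<le> D i (x k j $ i) (extrapolate T blk xt x \<alpha> k j) - D i (x k (j - 1) $ i) (extrapolate T blk xt x \<alpha> k j)"
      using bregman_decrease[OF i mem pos(1)] by (simp add: a_def b_def)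
    from mult_left_mono[OF this, of "\<kappa> * L k j / \<sigma> i"] show ?thesis
      using \<beta> \<kappa> \<sigma>[of i] pos(4) by (simp add: right_diff_distrib mult.assoc)
  qed
  \<comment> \<open>Both cross terms, from \<gamma> and from \<alpha>, are absorbed together with
    \<epsilon> equal to \<open>\<nu> * (\<kappa> - 1) * L k j\<close>; this yields the square of a
    sum in \<open>lambda_coeff\<close>.\<close>
  moreover have "(L k j * (\<gamma> k j + \<kappa> * LH i * \<alpha> k j / \<sigma> i) * a) * b
      \<le> \<nu> * (\<kappa> - 1) * L k j / 2 * b\<^sup>2
        + (L k j * (\<gamma> k j + \<kappa> * LH i * \<alpha> k j / \<sigma> i) * a)\<^sup>2 / (2 * (\<nu> * (\<kappa> - 1) * L k j))"
    using \<nu> \<kappa> pos by (intro young_inequality) simp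
  moreover have "(L k j * (\<gamma> k j + \<kappa> * LH i * \<alpha> k j / \<sigma> i) * a)\<^sup>2 / (2 * (\<nu> * (\<kappa> - 1) * L k j))
      = lambda_coeff blk \<sigma> LH \<nu> \<kappa> \<alpha> \<gamma> L i k (upd_count blk k j i) * a\<^sup>2"
    using j i pos by (simp add: lambda_coeff_def at_upd_upd_count power_mult_distrib power2_eq_square)
  moreover have "(L k j * (\<gamma> k j + \<kappa> * LH i * \<alpha> k j / \<sigma> i) * a) * b
      = L k j * (\<gamma> k j * a) * b + \<kappa> * L k j / \<sigma> i * (LH i * \<alpha> k j * a) * b"
    by (simp add: algebra_simps)
  moreover have "\<nu> * (\<kappa> - 1) * L k j / 2 * b\<^sup>2
      = \<kappa> * L k j / 2 * b\<^sup>2 - L k j / 2 * b\<^sup>2 - (1 - \<nu>) * (\<kappa> - 1) * L k j / 2 * b\<^sup>2"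
    by (simp add: field_simps)
  ultimately have "f (x k j) - f (x k (j - 1)) \<le> g w \<bullet> (x k j $ i - x k (j - 1) $ i)
      + (1 / \<beta> k j * D i (x k j $ i) (extrapolate T blk xt x \<alpha> k j)
        - 1 / \<beta> k j * D i (x k (j - 1) $ i) (extrapolate T blk xt x \<alpha> k j))
      + lambda_coeff blk \<sigma> LH \<nu> \<kappa> \<alpha> \<gamma> L i k (upd_count blk k j i) * a\<^sup>2
      - (1 - \<nu>) * (\<kappa> - 1) * L k j / 2 * b\<^sup>2"
    unfolding inner_diff_left by linarith
  then show "f (x k j) - f (x k (j - 1)) \<le> IBPG_model \<gamma> k j (x k j $ i) - IBPG_model \<gamma> k j (x k (j - 1) $ i)
      + lambda_coeff blk \<sigma> LH \<nu> \<kappa> \<alpha> \<gamma> L i k (upd_count blk k j i) * (norm (x k (j - 1) $ i - y k (j - 1) $ i))\<^sup>2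
      - (1 - \<nu>) * (\<kappa> - 1) * L k j / 2 * (norm (x k j $ i - x k (j - 1) $ i))\<^sup>2"
    by (simp add: IBPG_model_def IBPG_grad_def i[symmetric] a_def b_def g_def w_def inner_diff_right)
qed (use S f r_proper r_lsc updates \<delta> W in auto)

text \<open>The model gradients are blocks of the full gradient at points that tend to z, so they
  converge by continuity. An upper bound on L bounds \<open>1 / \<beta>\<close> by a constant that
  depends on the block through \<open>\<sigma> i\<close>.\<close>

lemma IBPG_majorants:
  assumes fC1: "C1_on (block_space E) f"
    and iter: "IBPG_iterates E f r H T blk \<alpha> \<beta> \<gamma> xt x"
    and \<kappa>: "1 < \<kappa>"
    and params: "IBPG_params E f T blk x \<sigma> LH \<nu> \<delta> \<kappa> \<alpha> \<beta> \<gamma> L"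
    and bounds: "IBPG_bounds T blk \<sigma> LH \<nu> \<kappa> \<alpha> \<gamma> L"
  shows "z \<in> block_space E \<and> (\<forall>i. \<bar>r i (z $ i)\<bar> \<noteq> \<infinity>) \<and>
    (\<exists>C. \<forall>i. \<forall>u\<in>E i. r i (z $ i) \<le> r i u
       + ereal (gradient_on (block_space E) f z $ i \<bullet> (u - z $ i) + C i * D i u (z $ i)))"
proof -
  obtain W Lmax \<alpha>max \<gamma>max where W: "0 < W"
    and b: "\<And>i k m. 1 \<le> k \<Longrightarrow> m \<in> {1..num_upd T blk k i} \<Longrightarrow>
      W \<le> lambda_coeff blk \<sigma> LH \<nu> \<kappa> \<alpha> \<gamma> L i k m \<and> at_upd blk L i k m \<le> Lmax \<and>
      at_upd blk \<alpha> i k m \<le> \<alpha>max \<and> at_upd blk \<gamma> i k m \<le> \<gamma>max"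
    using bounds unfolding IBPG_bounds_def by metis
  have bnd: "\<bar>\<alpha> k j\<bar> \<le> \<alpha>max" "\<bar>\<gamma> k j\<bar> \<le> \<gamma>max" "0 < \<beta> k j"
      "1 / \<beta> k j \<le> \<kappa> * Lmax / \<sigma> (blk k j)"
    if "1 \<le> k" "j \<in> {1..T k}" for k j
  proof -
    have m: "upd_count blk k j (blk k j) \<in> {1..num_upd T blk k (blk k j)}"
      using upd_count_in_range[of j T k blk, OF that(2) refl] .
    have "at_upd blk \<beta> (blk k j) k (upd_count blk k j (blk k j))
        = \<sigma> (blk k j) / (\<kappa> * at_upd blk L (blk k j) k (upd_count blk k j (blk k j)))"
      using params that(1) m by (auto simp: IBPG_params_def)
    then have \<beta>: "\<beta> k j = \<sigma> (blk k j) / (\<kappa> * L k j)" using that by (simp add: at_upd_upd_count)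
    show "\<bar>\<alpha> k j\<bar> \<le> \<alpha>max" "\<bar>\<gamma> k j\<bar> \<le> \<gamma>max" "0 < \<beta> k j"
      using b[OF that(1) m] that params by (auto simp: at_upd_upd_count IBPG_params_def)
    have "\<kappa> * L k j \<le> \<kappa> * Lmax"
      using b[OF that(1) m] that \<kappa> by (intro mult_left_mono) (auto simp: at_upd_upd_count)
    then show "1 / \<beta> k j \<le> \<kappa> * Lmax / \<sigma> (blk k j)"
      using \<sigma>[of "blk k j"] by (simp add: \<beta> divide_right_mono)
  qed
  interpret inertial_block_scheme_limit_point E f r T blk xt x "IBPG_model \<gamma>"
    "lambda_coeff blk \<sigma> LH \<nu> \<kappa> \<alpha> \<gamma> L" "\<lambda>k j. (1 - \<nu>) * (\<kappa> - 1) * L k j / 2" \<delta> W z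
    using IBPG_scheme[OF fC1 iter \<kappa> params W] b limit_point
    by (simp add: inertial_block_scheme_limit_point_def inertial_block_scheme_limit_point_axioms_def)
  let ?G = "gradient_on (block_space E) f"
  have key: "r i (z $ i) \<le> r i u + ereal (?G z $ i \<bullet> (u - z $ i) + \<kappa> * Lmax / \<sigma> i * D i u (z $ i))"
    if u: "u \<in> E i" for i u
  proof -
    obtain K J where K: "\<And>n. 1 \<le> K n" and J: "\<And>n. J n \<in> {1..T (K n)}"
      and blk: "\<And>n. blk (K n) (J n) = i"
      and lim: "(\<lambda>n. x (K n) (J n)) \<longlonglongrightarrow> z" "(\<lambda>n. x (K n) (J n - 1)) \<longlonglongrightarrow> z"
        "(\<lambda>n. y (K n) (J n - 1) $ i) \<longlonglongrightarrow> z $ i"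
      by (rule update_times[of i]) (rule that)
    define v where "v n = extrapolate T blk xt x \<alpha> (K n) (J n)" for n
    define w where "w n = extrapolate T blk xt x \<gamma> (K n) (J n)" for n
    have J': "J n \<le> T (K n)" "J n - 1 \<le> T (K n)" for n using J[of n] by auto
    have mem: "x (K n) (J n) \<in> block_space E" "x (K n) (J n - 1) \<in> block_space E"
      "y (K n) (J n - 1) \<in> block_space E" for n
      using x_mem[OF K J'(1)] x_mem[OF K J'(2)] prev_mem[OF J'(2)] by auto
    have vw: "v n \<in> E i" "w n \<in> E i" for n
      using extrapolate_mem[OF mem(2,3)] blk by (metis v_def, metis w_def)
    have grad: "IBPG_grad \<gamma> (K n) (J n) = ?G (block_upd (x (K n) (J n - 1)) i (w n)) $ i" for n
      using gradient_on_block_fun[OF S _ mem(2) vw(2)] fC1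
      by (simp add: IBPG_grad_def block_fun_eq blk w_def C1_on_def)
    have vlim: "v \<longlonglongrightarrow> z $ i"
      unfolding v_def[abs_def] using bnd(1)[OF K J] by (intro tendsto_extrapolate lim blk)
    have wlim: "w \<longlonglongrightarrow> z $ i"
      unfolding w_def[abs_def] using bnd(2)[OF K J] by (intro tendsto_extrapolate lim blk)
    have "(\<lambda>n. ?G (block_upd (x (K n) (J n - 1)) i (w n))) \<longlonglongrightarrow> ?G (block_upd z i (z $ i))"
      using fC1 unfolding C1_on_def
      by (intro continuous_on_tendsto_compose[of "block_space E" ?G] tendsto_block_upd lim wlim)
        (auto intro!: always_eventually block_upd_mem z_mem z_nth_mem mem vw simp del: One_nat_def)
    then have glim: "(\<lambda>n. IBPG_grad \<gamma> (K n) (J n)) \<longlonglongrightarrow> ?G z $ i"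
      unfolding grad by (auto dest: tendsto_vec_nth)
    show ?thesis
    proof (rule r_limit_le[OF K J blk lim(1) u])
      fix n
      have "1 / \<beta> (K n) (J n) * D i u (v n) \<le> \<kappa> * Lmax / \<sigma> i * D i u (v n)"
        using bnd(4)[OF K J, of n] blk by (intro mult_right_mono D_nonneg u vw) auto
      moreover have "0 \<le> 1 / \<beta> (K n) (J n) * D i (x (K n) (J n) $ i) (v n)"
        using bnd(3)[OF K J, of n] mem(1)[of n] by (intro mult_nonneg_nonneg D_nonneg vw) (auto simp: block_space_def)
      ultimately show "IBPG_model \<gamma> (K n) (J n) u - IBPG_model \<gamma> (K n) (J n) (x (K n) (J n) $ i)
          \<le> IBPG_grad \<gamma> (K n) (J n) \<bullet> (u - x (K n) (J n) $ i) + \<kappa> * Lmax / \<sigma> i * D i u (v n)"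
        by (simp add: IBPG_model_def blk v_def inner_diff_right)
    next
      show "(\<lambda>n. IBPG_grad \<gamma> (K n) (J n) \<bullet> (u - x (K n) (J n) $ i) + \<kappa> * Lmax / \<sigma> i * D i u (v n))
          \<longlonglongrightarrow> ?G z $ i \<bullet> (u - z $ i) + \<kappa> * Lmax / \<sigma> i * D i u (z $ i)"
        by (intro tendsto_add tendsto_mult tendsto_const tendsto_inner tendsto_diff glim
            tendsto_vec_nth lim tendsto_D vlim vw z_nth_mem)
    qed
  qed
  then have "\<bar>r i (z $ i)\<bar> \<noteq> \<infinity>" for i by (rule r_z_finite)
  with z_mem key show ?thesis by (intro conjI allI exI[of _ "\<lambda>i. \<kappa> * Lmax / \<sigma> i"] ballI)
qed

end

section \<open>Criticality of the limit points\<close>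

theorem theorem1:
  fixes E :: "'s::finite \<Rightarrow> 'a::euclidean_space set"
    and f :: "'a^'s \<Rightarrow> real"
    and r :: "'s \<Rightarrow> 'a \<Rightarrow> ereal"
    and H :: "'s \<Rightarrow> 'a \<Rightarrow> real"
    and \<sigma> LH :: "'s \<Rightarrow> real"
    and \<nu> \<delta> \<kappa> :: real
    and T :: "nat \<Rightarrow> nat"
    and blk :: "nat \<Rightarrow> nat \<Rightarrow> 's"
    and \<alpha> \<beta> \<gamma> L :: "nat \<Rightarrow> nat \<Rightarrow> real"
    and xt :: "nat \<Rightarrow> 'a^'s"
    and x :: "nat \<Rightarrow> nat \<Rightarrow> 'a^'s"
  assumes "\<And>i. subspace (E i)"
    and "continuous_on (block_space E) f"
    and "\<And>i. proper_on (E i) (r i)"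
    and "\<And>i. lsc_on (E i) (r i)"
    and "kernel_assms E H \<sigma> LH"
    and "updates_all_blocks T blk"
    and "0 < \<nu>" and "\<nu> < 1" and "1 < \<delta>"
  shows
    "(IBP_iterates E f r H T blk \<alpha> \<beta> xt x \<and>
      IBP_params T blk \<sigma> LH \<nu> \<delta> \<alpha> \<beta> \<and>
      IBP_bounds T blk \<sigma> LH \<nu> \<alpha> \<beta> \<longrightarrow>
        ((\<forall>z\<in>edom (block_space E) (objective f r). regular_at E (objective f r) z) \<longrightarrow>
           (\<forall>z. seq_limit_point xt z \<longrightarrow> critical_type_I (block_space E) (objective f r) z)) \<and>
        (C1_on (block_space E) f \<longrightarrow>
           (\<forall>z. seq_limit_point xt z \<longrightarrow> critical_type_II (block_space E) (objective f r) z)))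
     \<and>
     (C1_on (block_space E) f \<and>
      IBPG_iterates E f r H T blk \<alpha> \<beta> \<gamma> xt x \<and>
      1 < \<kappa> \<and>
      IBPG_params E f T blk x \<sigma> LH \<nu> \<delta> \<kappa> \<alpha> \<beta> \<gamma> L \<and>
      IBPG_bounds T blk \<sigma> LH \<nu> \<kappa> \<alpha> \<gamma> L \<longrightarrow>
        (\<forall>z. seq_limit_point xt z \<longrightarrow> critical_type_II (block_space E) (objective f r) z))"
proof (intro conjI impI allI; (elim conjE)?)
  fix z assume "seq_limit_point xt z"
  then interpret inertial_block_problem E f r H \<sigma> LH \<nu> \<delta> T blk \<alpha> \<beta> xt x z
    using assms by unfold_locales
  assume "IBP_iterates E f r H T blk \<alpha> \<beta> xt x" "IBP_params T blk \<sigma> LH \<nu> \<delta> \<alpha> \<beta>"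
    "IBP_bounds T blk \<sigma> LH \<nu> \<alpha> \<beta>"
  from IBP_majorants[OF this] obtain C where z: "z \<in> block_space E" "\<And>i. \<bar>r i (z $ i)\<bar> \<noteq> \<infinity>"
    and key: "\<And>i u. u \<in> E i \<Longrightarrow>
      r i (z $ i) \<le> r i u + ereal (f (block_upd z i u) - f z + C * D i u (z $ i))"
    by blast
  \<comment> \<open>Regularity is given only on the domain, so membership of z is settled before it
    is invoked.\<close>
  have dom: "z \<in> edom (block_space E) (objective f r)"
    using z by (simp add: edom_objective_iff[OF r_proper])
  have zi: "z $ i \<in> E i" for i using z by (simp add: block_space_def)
  note D' = has_derivative_scaled_bregman[OF S zi H_diff, where c = C]
  {
    assume "\<forall>z\<in>edom (block_space E) (objective f r). regular_at E (objective f r) z"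
    with dom have "regular_at E (objective f r) z" by blast
    with S z dom show "critical_type_I (block_space E) (objective f r) z"
      by (rule critical_type_I_if_block_majorants[where p = "\<lambda>i u. C * D i u (z $ i)"]) (use key D' in auto)
  next
    assume fC1: "C1_on (block_space E) f"
    let ?G = "gradient_on (block_space E) f z"
    have fdiff: "f differentiable_on block_space E" using fC1 by (simp add: C1_on_def)
    have f': "(f has_derivative (\<lambda>v. ?G \<bullet> v)) (at z within block_space E)"
      by (rule has_derivative_gradient_on[OF subspace_block_space[OF S] z(1) fdiff])
    \<comment> \<open>The block function contributes block i of the gradient at z; the Bregman term
      contributes derivative 0.\<close>
    have q: "((\<lambda>u. f (block_upd z i u) - f z + C * D i u (z $ i)) has_derivative (\<lambda>v. ?G $ i \<bullet> v))
        (at (z $ i) within E i)" for i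
      using has_derivative_add[OF has_derivative_diff[OF has_derivative_block_fun[OF S fdiff z(1) zi] has_derivative_const[of "f z"]] D']
      by simp
    show "critical_type_II (block_space E) (objective f r) z"
      by (rule critical_type_II_if_block_majorants
          [where q = "\<lambda>i u. f (block_upd z i u) - f z + C * D i u (z $ i)", OF S z dom f' key _ q]) auto
  }
next
  fix z assume "seq_limit_point xt z"
  then interpret inertial_block_problem E f r H \<sigma> LH \<nu> \<delta> T blk \<alpha> \<beta> xt x z
    using assms by unfold_locales
  assume fC1: "C1_on (block_space E) f"
  assume "IBPG_iterates E f r H T blk \<alpha> \<beta> \<gamma> xt x" "1 < \<kappa>"
    "IBPG_params E f T blk x \<sigma> LH \<nu> \<delta> \<kappa> \<alpha> \<beta> \<gamma> L" "IBPG_bounds T blk \<sigma> LH \<nu> \<kappa> \<alpha> \<gamma> L"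
  from IBPG_majorants[OF fC1 this] obtain C where z: "z \<in> block_space E" "\<And>i. \<bar>r i (z $ i)\<bar> \<noteq> \<infinity>"
    and key: "\<And>i u. u \<in> E i \<Longrightarrow> r i (z $ i) \<le> r i u
      + ereal (gradient_on (block_space E) f z $ i \<bullet> (u - z $ i) + C i * D i u (z $ i))"
    by blast
  let ?G = "gradient_on (block_space E) f z"
  have dom: "z \<in> edom (block_space E) (objective f r)"
    using z by (simp add: edom_objective_iff[OF r_proper])
  have zi: "z $ i \<in> E i" for i using z by (simp add: block_space_def)
  have fdiff: "f differentiable_on block_space E" using fC1 by (simp add: C1_on_def)
  have f': "(f has_derivative (\<lambda>v. ?G \<bullet> v)) (at z within block_space E)"
    by (rule has_derivative_gradient_on[OF subspace_block_space[OF S] z(1) fdiff])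
  have q: "((\<lambda>u. ?G $ i \<bullet> (u - z $ i) + C i * D i u (z $ i)) has_derivative (\<lambda>v. ?G $ i \<bullet> v))
      (at (z $ i) within E i)" for i
    by (rule derivative_eq_intros refl has_derivative_scaled_bregman[OF S zi H_diff])+ simp
  show "critical_type_II (block_space E) (objective f r) z"
    by (rule critical_type_II_if_block_majorants
        [where q = "\<lambda>i u. ?G $ i \<bullet> (u - z $ i) + C i * D i u (z $ i)", OF S z dom f' key _ q]) auto
qed

end
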